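(* Let $G$ be a finite group. Then the following are equivalent: (i) for every $n\ge 1$ and all $\theta,\pi\in B_n$ with $s(\theta)=s(\pi)$, one has $\Pr_\theta(G)=\Pr_\pi(G)$; (ii) $G$ is ambivalent.
   Context: A finite group $G$ is ambivalent if every $g\in G$ is conjugate in $G$ to $g^{-1}$. $B_n$ is the group of permutations $\pi$ of $\{\pm1,\dots,\pm n\}$ with $\pi_{-i}=-\pi_i$. For $\pi\in B_n$, $\Pr_\pi(G)$ is the probability, over independent uniformly random $a_1,\dots,a_n\in G$, that $a_1\cdots a_n=a_{|\pi_1|}^{\epsilon_1}\cdots a_{|\pi_n|}^{\epsilon_n}$, where $\epsilon_i=1$ if $\pi_i>0$ and $\epsilon_i=-1$ if $\pi_i<0$. Let $H_n=\{+0,+1,\dots,+n,-0,-1,\dots,-n\}$ ($2n+2$ distinct elements), with negation $-(+j)=-j$, $-(-j)=+j$; extend $\pi$ by $\pi_{+0}=+0$, $\pi_{-0}=-0$. The successor $i\mapsto i+1$ on $H_n$ is $+0\mapsto+1\mapsto\cdots\mapsto+n\mapsto+0$ and $-n\mapsto-(n-1)\mapsto\cdots\mapsto-1\mapsto-0\mapsto-n$. The breakpoint graph $\mathrm{Gr}(\pi)$ has vertex set $H_n$, gray edges $\{i,-(i+1)\}$ and black edges $\{\pi_i,\pi_{-(i+1)}\}$ for $i\in H_n$ (undirected; each colour class is a perfect matching). $s(\pi)$ is the number of cycles of $\mathrm{Gr}(\pi)$ alternating between black and gray edges. *)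

theory Defs
  imports "HOL-Algebra.Algebra" "HOL-Combinatorics.Permutations" "HOL-Probability.Probability"
begin

text \<open>Integers with two distinct zeros, \<open>Pos 0\<close> and \<open>Neg 0\<close>.\<close>

datatype signed_nat = Pos nat | Neg nat

primrec negate :: "signed_nat \<Rightarrow> signed_nat" where
  "negate (Pos j) = Neg j"
| "negate (Neg j) = Pos j"

definition H_set :: "nat \<Rightarrow> signed_nat set" where
  "H_set n = Pos ` {0..n} \<union> Neg ` {0..n}"

definition nonzero_set :: "nat \<Rightarrow> signed_nat set" where
  "nonzero_set n = Pos ` {1..n} \<union> Neg ` {1..n}"

text \<open>A map that \<open>permutes\<close> a set is the identity outside of it, so every element of
  \<open>hyperoct n\<close> already fixes both zeros; no separate extension to \<open>H_set n\<close> is needed.\<close>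

definition hyperoct :: "nat \<Rightarrow> (signed_nat \<Rightarrow> signed_nat) set" where
  "hyperoct n = {\<pi>. \<pi> permutes nonzero_set n \<and>
                    (\<forall>i\<in>nonzero_set n. \<pi> (negate i) = negate (\<pi> i))}"

text \<open>Only meaningful on \<open>H_set n\<close>. It permutes the two signed halves cyclically and separately:
  \<open>Neg 1\<close> is followed by \<open>Neg 0\<close>, and \<open>Neg 0\<close> by \<open>Neg n\<close>.\<close>

fun cyc_succ :: "nat \<Rightarrow> signed_nat \<Rightarrow> signed_nat" where
  "cyc_succ n (Pos j) = (if j = n then Pos 0 else Pos (Suc j))"
| "cyc_succ n (Neg j) = (if j = 0 then Neg n else Neg (j - 1))"

text \<open>The colours are kept as tags because a gray and a black edge may join the same two vertices;
  they are then parallel edges that form a cycle of length two.\<close>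

datatype colour = Gray | Black

definition breakpoint_graph ::
    "nat \<Rightarrow> (signed_nat \<Rightarrow> signed_nat) \<Rightarrow> (colour \<times> signed_nat set) set" where
  "breakpoint_graph n \<pi> =
     {(Gray, {i, negate (cyc_succ n i)}) | i. i \<in> H_set n} \<union>
     {(Black, {\<pi> i, \<pi> (negate (cyc_succ n i))}) | i. i \<in> H_set n}"

text \<open>The coloured edges of the closed walk through \<open>vs\<close>, starting with a gray edge.\<close>

definition closed_walk_edges :: "signed_nat list \<Rightarrow> (colour \<times> signed_nat set) set" where
  "closed_walk_edges vs =
     (\<lambda>k. (if even k then Gray else Black, {vs ! k, vs ! (Suc k mod length vs)})) ` {..<length vs}"

text \<open>A cycle is identified with its set of coloured edges, so that the choice of starting vertex
  and of direction does not matter.\<close>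

definition alternating_cycles ::
    "nat \<Rightarrow> (signed_nat \<Rightarrow> signed_nat) \<Rightarrow> (colour \<times> signed_nat set) set set" where
  "alternating_cycles n \<pi> =
     {closed_walk_edges vs | vs. vs \<noteq> [] \<and> even (length vs) \<and> distinct vs \<and>
                                 closed_walk_edges vs \<subseteq> breakpoint_graph n \<pi>}"

definition num_cycles :: "nat \<Rightarrow> (signed_nat \<Rightarrow> signed_nat) \<Rightarrow> nat" where
  "num_cycles n \<pi> = card (alternating_cycles n \<pi>)"

definition list_prod :: "('a, 'b) monoid_scheme \<Rightarrow> 'a list \<Rightarrow> 'a" where
  "list_prod G xs = foldr (\<otimes>\<^bsub>G\<^esub>) xs \<one>\<^bsub>G\<^esub>"

text \<open>\<open>a\<close> to the power of the sign, at the absolute value of the index.\<close>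

primrec signed_value :: "('a, 'b) monoid_scheme \<Rightarrow> (nat \<Rightarrow> 'a) \<Rightarrow> signed_nat \<Rightarrow> 'a" where
  "signed_value G a (Pos j) = a j"
| "signed_value G a (Neg j) = inv\<^bsub>G\<^esub> (a j)"

definition perm_prob ::
    "('a, 'b) monoid_scheme \<Rightarrow> nat \<Rightarrow> (signed_nat \<Rightarrow> signed_nat) \<Rightarrow> real" where
  "perm_prob G n \<pi> =
     measure_pmf.prob (Pi_pmf {1..n} undefined (\<lambda>_. pmf_of_set (carrier G)))
       {a. list_prod G (map a [1..<Suc n]) =
           list_prod G (map (\<lambda>i. signed_value G a (\<pi> (Pos i))) [1..<Suc n])}"

definition ambivalent :: "('a, 'b) monoid_scheme \<Rightarrow> bool" where
  "ambivalent G \<longleftrightarrow>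
     (\<forall>g\<in>carrier G. \<exists>h\<in>carrier G. h \<otimes>\<^bsub>G\<^esub> g \<otimes>\<^bsub>G\<^esub> inv\<^bsub>G\<^esub> h = inv\<^bsub>G\<^esub> g)"

end

theory Submission
  imports Defs
begin

text \<open>
  The equation that defines the probability says that the word \<open>w = 1 \<dots> n (\<pi>\<^sub>1 \<dots> \<pi>\<^sub>n)\<inverse>\<close> has
  value one. Every letter occurs twice in \<open>w\<close>, so \<open>w\<close> glues a polygon to a closed surface, and
  the alternating cycles of the breakpoint graph are the vertices of the glued polygon. Three moves
  reduce any such word: \<open>P l A l Q\<close> becomes \<open>P A\<inverse> Q\<close> while a square splits off;
  \<open>P l l\<inverse> Q\<close> becomes \<open>P Q\<close> while a vertex and a factor \<open>|G|\<close> disappear; and, in an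
  ambivalent group only, \<open>P l A l\<inverse> Q\<close> and \<open>P l A\<inverse> l\<inverse> Q\<close> have equally many solutions,
  because \<open>A\<close> and \<open>A\<inverse>\<close> are conjugate. The last move makes orientable surfaces
  nonorientable, so that the number of solutions depends on \<open>n\<close> and the number of vertices only.
  Conversely, torus and Klein bottle have one vertex each, and the equality of their probabilities
  says that as many pairs satisfy \<open>x y x\<inverse> = y\<inverse>\<close> as commute, which forces every \<open>y\<close> to be
  conjugate to its inverse.
\<close>

subsection \<open>Words in which every letter occurs twice\<close>

primrec letter :: "signed_nat \<Rightarrow> nat" where
  "letter (Pos j) = j"
| "letter (Neg j) = j"

lemma letter_negate [simp]: "letter (negate l) = letter l"
  by (cases l) auto

lemma negate_negate [simp]: "negate (negate l) = l"
  by (cases l) auto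

lemma negate_neq [simp]: "negate l \<noteq> l" "l \<noteq> negate l"
  by (cases l; simp)+

lemma letter_eq_iff: "letter k = letter l \<longleftrightarrow> k = l \<or> k = negate l"
  by (cases k; cases l) auto

definition letters :: "signed_nat list \<Rightarrow> nat set" where
  "letters w = letter ` set w"

lemma letters_simps [simp]:
  "letters [] = {}" "letters (l # w) = insert (letter l) (letters w)"
  "letters (u @ w) = letters u \<union> letters w"
  by (auto simp: letters_def)

lemma finite_letters [simp]: "finite (letters w)"
  by (simp add: letters_def)

definition word_inverse :: "signed_nat list \<Rightarrow> signed_nat list" where
  "word_inverse w = map negate (rev w)"

lemma word_inverse_simps [simp]:
  "word_inverse [] = []" "word_inverse (l # w) = word_inverse w @ [negate l]"
  "length (word_inverse w) = length w" "word_inverse (u @ w) = word_inverse w @ word_inverse u"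
  by (auto simp: word_inverse_def)

lemma letters_word_inverse [simp]: "letters (word_inverse w) = letters w"
  by (induction w) auto

lemma image_mset_letter_word_inverse [simp]:
  "image_mset letter (mset (word_inverse w)) = image_mset letter (mset w)"
  by (induction w) auto

definition double_word :: "signed_nat list \<Rightarrow> bool" where
  "double_word w \<longleftrightarrow> (\<forall>x\<in>letters w. count (image_mset letter (mset w)) x = 2)"

lemma count_letters_eq_0_iff: "count (image_mset letter (mset w)) x = 0 \<longleftrightarrow> x \<notin> letters w"
  by (simp add: letters_def count_eq_zero_iff del: count_image_mset)

lemma double_wordD:
  assumes "double_word (P @ k # A @ l # Q)" and "letter k = letter l"
  shows "letter l \<notin> letters (P @ A @ Q)"
proof -
  have "count (image_mset letter (mset (P @ k # A @ l # Q))) (letter l) = 2"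
    using assms(1) by (simp add: double_word_def del: count_image_mset)
  hence "count (image_mset letter (mset (P @ A @ Q))) (letter l) = 0"
    using assms(2) by (simp del: count_image_mset)
  thus ?thesis by (simp only: count_letters_eq_0_iff not_False_eq_True)
qed

lemma double_word_ex_partner:
  assumes "double_word (U @ b # V)"
  shows "letter b \<in> letters (U @ V)"
proof -
  have "count (image_mset letter (mset (U @ b # V))) (letter b) = 2"
    using assms by (simp add: double_word_def del: count_image_mset)
  hence "count (image_mset letter (mset (U @ V))) (letter b) \<noteq> 0"
    by (simp del: count_image_mset)
  thus ?thesis by (simp only: count_letters_eq_0_iff not_not)
qed

lemma letters_split:
  assumes "letter b \<in> letters w"
  obtains u k v where "w = u @ k # v" "k = b \<or> k = negate b"
proof -
  from assms obtain k where "k \<in> set w" "letter k = letter b"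
    by (auto simp: letters_def)
  thus ?thesis using that by (metis letter_eq_iff split_list)
qed

text \<open>The counts of the other letters do not change. Fixing \<open>w\<close> only up to order
  and signs covers both \<open>P @ Q\<close> and \<open>P @ word_inverse A @ Q\<close>.\<close>

lemma double_word_removeD:
  assumes "double_word (P @ k # A @ l # Q)" and "letter k = letter l"
    and "image_mset letter (mset w) = image_mset letter (mset (P @ A @ Q))"
  shows "double_word w"
proof -
  have ls: "letters w = letters (P @ A @ Q)"
    using arg_cong[OF assms(3), of set_mset] by (simp add: letters_def image_Un)
  show ?thesis
    unfolding double_word_def
  proof
    fix x assume x: "x \<in> letters w"
    hence "x \<noteq> letter l" "x \<in> letters (P @ k # A @ l # Q)"
      using double_wordD[OF assms(1,2)] ls by auto
    moreover from this have "count (image_mset letter (mset (P @ k # A @ l # Q))) x = 2"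
      using assms(1) unfolding double_word_def by blast
    ultimately show "count (image_mset letter (mset w)) x = 2"
      using assms(2,3) by (simp del: count_image_mset)
  qed
qed

lemma double_word_cong:
  assumes "double_word w" and "image_mset letter (mset w') = image_mset letter (mset w)"
  shows "double_word w'"
proof -
  have "letters w' = letters w"
    using arg_cong[OF assms(2), of set_mset] by (simp add: letters_def)
  thus ?thesis using assms by (simp add: double_word_def del: count_image_mset)
qed

section \<open>Counting assignments by freeing one letter\<close>

lemma sum_if_card:
  "finite D \<Longrightarrow> (\<Sum>x\<in>D. if R x then k else 0) = k * card {x \<in> D. R x}" for k :: nat
  by (simp flip: sum.inter_filter)

text \<open>A Fubini argument: fix the values on \<open>D\<close>, then count the admissible values
  \<open>t\<close> at \<open>x\<close>. All later counts of colourings and solutions free one letter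
  this way.\<close>

lemma card_PiE_insert:
  assumes "finite D" and "finite B" and "x \<notin> D"
  shows "card {a \<in> insert x D \<rightarrow>\<^sub>E B. R a} = (\<Sum>a\<in>(D \<rightarrow>\<^sub>E B). card {t \<in> B. R (a(x := t))})"
proof -
  let ?S = "SIGMA a:(D \<rightarrow>\<^sub>E B). {t \<in> B. R (a(x := t))}"
  have "bij_betw (\<lambda>(a, t). a(x := t)) ?S {a \<in> insert x D \<rightarrow>\<^sub>E B. R a}"
  \<comment> \<open>Extensional functions are \<open>undefined\<close> outside their domain, so this
    value is restored when \<open>x\<close> leaves the domain.\<close>
  proof (rule bij_betw_byWitness[where f' = "\<lambda>a. (a(x := undefined), a x)"])
    show "\<forall>p\<in>?S. (\<lambda>a. (a(x := undefined), a x)) ((\<lambda>(a, t). a(x := t)) p) = p"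
      using assms(3) by (auto simp: PiE_def extensional_def fun_eq_iff)
    show "\<forall>a\<in>{a \<in> insert x D \<rightarrow>\<^sub>E B. R a}.
        (\<lambda>(a, t). a(x := t)) ((\<lambda>a. (a(x := undefined), a x)) a) = a"
      by auto
    show "(\<lambda>(a, t). a(x := t)) ` ?S \<subseteq> {a \<in> insert x D \<rightarrow>\<^sub>E B. R a}"
      by (auto simp: PiE_def extensional_def Pi_def)
    show "(\<lambda>a. (a(x := undefined), a x)) ` {a \<in> insert x D \<rightarrow>\<^sub>E B. R a} \<subseteq> ?S"
      using assms(3) by (auto simp: PiE_def extensional_def Pi_def)
  qed
  hence "card ?S = card {a \<in> insert x D \<rightarrow>\<^sub>E B. R a}"
    by (rule bij_betw_same_card)
  thus ?thesis
    using assms by (simp add: card_SigmaI finite_PiE)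
qed

subsection \<open>Colourings of a word\<close>

text \<open>The value \<open>(p, r)\<close> of a letter is an arrow from \<open>p\<close> to
  \<open>r\<close> in the pair groupoid on \<open>'c\<close>. Words evaluated there obey the same
  moves as words in a group, so colourings and solutions can be reduced in parallel.\<close>

primrec source :: "(nat \<Rightarrow> 'c \<times> 'c) \<Rightarrow> signed_nat \<Rightarrow> 'c" where
  "source a (Pos j) = fst (a j)"
| "source a (Neg j) = snd (a j)"

definition target :: "(nat \<Rightarrow> 'c \<times> 'c) \<Rightarrow> signed_nat \<Rightarrow> 'c" where
  "target a l = source a (negate l)"

text \<open>A letter is read as an arrow between two points, traversed backwards if the letter is negative;
  \<open>walk a c w d\<close> says that the arrows of \<open>w\<close> compose to an arrow from \<open>c\<close> to \<open>d\<close>.\<close>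

primrec walk :: "(nat \<Rightarrow> 'c \<times> 'c) \<Rightarrow> 'c \<Rightarrow> signed_nat list \<Rightarrow> 'c \<Rightarrow> bool" where
  "walk a c [] d \<longleftrightarrow> c = d"
| "walk a c (l # w) d \<longleftrightarrow> source a l = c \<and> walk a (target a l) w d"

lemma walk_append: "walk a c (u @ w) d \<longleftrightarrow> (\<exists>e. walk a c u e \<and> walk a e w d)"
  by (induction u arbitrary: c) auto

lemma walk_word_inverse: "walk a c (word_inverse w) d \<longleftrightarrow> walk a d w c"
  by (induction w arbitrary: c d) (auto simp: walk_append target_def)

lemma walk_functional: "walk a c w d \<Longrightarrow> walk a c w d' \<Longrightarrow> d = d'"
  by (induction w arbitrary: c) auto

lemma walk_upd [simp]: "x \<notin> letters w \<Longrightarrow> walk (a(x := t)) c w d \<longleftrightarrow> walk a c w d"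
proof (induction w arbitrary: c)
  case (Cons l w)
  thus ?case by (cases l) (auto simp: target_def)
qed auto

text \<open>The value to store at \<open>letter l\<close> so that \<open>l\<close> itself, of either
  sign, runs from \<open>p\<close> to \<open>r\<close>.\<close>

definition arrow :: "signed_nat \<Rightarrow> 'c \<Rightarrow> 'c \<Rightarrow> 'c \<times> 'c" where
  "arrow l p r = (case l of Pos _ \<Rightarrow> (p, r) | Neg _ \<Rightarrow> (r, p))"

lemma arrow_cases: obtains p r where "t = arrow l p r"
  by (cases t; cases l; simp add: arrow_def)

lemma arrow_eq_iff [simp]: "arrow l p r = arrow l p' r' \<longleftrightarrow> p = p' \<and> r = r'"
  by (cases l) (auto simp: arrow_def)

lemma source_arrow [simp]: "source (a(letter l := arrow l p r)) l = p"
  and target_arrow [simp]: "target (a(letter l := arrow l p r)) l = r"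
  and source_negate [simp]: "source b (negate l) = target b l"
  and target_negate [simp]: "target b (negate l) = source b l"
  by (cases l; simp add: target_def arrow_def)+

text \<open>Both occurrences of \<open>l\<close> run from \<open>p\<close> to \<open>r\<close>, so
  \<open>A\<close> must lead from \<open>r\<close> back to \<open>p\<close>. The detour
  \<open>l A l\<close> joins the same points as \<open>A\<close> read backwards.\<close>

lemma walk_same_iff:
  assumes "letter l \<notin> letters (P @ A @ Q)"
  shows "walk (a(letter l := t)) c (P @ l # A @ l # Q) d \<longleftrightarrow>
    (\<exists>p r. t = arrow l p r \<and> walk a c P p \<and> walk a p (word_inverse A) r \<and> walk a r Q d)"
proof -
  obtain p r where "t = arrow l p r" by (rule arrow_cases)
  thus ?thesis using assms by (simp add: walk_append walk_word_inverse)
qed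

lemma walk_cancel_iff:
  assumes "letter l \<notin> letters (P @ Q)"
  shows "walk (a(letter l := t)) c (P @ l # negate l # Q) d \<longleftrightarrow>
    (\<exists>p r. t = arrow l p r \<and> walk a c P p \<and> walk a p Q d)"
proof -
  obtain p r where "t = arrow l p r" by (rule arrow_cases)
  thus ?thesis using assms by (simp add: walk_append)
qed

text \<open>\<open>p\<close> is forced by the walk along \<open>P\<close> and \<open>r\<close> by
  the walk along the inverse of \<open>A\<close>, so exactly one arrow fits.\<close>

lemma card_walk_same:
  fixes a :: "nat \<Rightarrow> 'c \<times> 'c"
  assumes "letter l \<notin> letters (P @ A @ Q)"
  shows "card {t \<in> UNIV. walk (a(letter l := t)) c (P @ l # A @ l # Q) d} =
    (if walk a c (P @ word_inverse A @ Q) d then 1 else 0)"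
proof (cases "walk a c (P @ word_inverse A @ Q) d")
  case True
  then obtain p r where pr: "walk a c P p" "walk a p (word_inverse A) r" "walk a r Q d"
    by (auto simp only: walk_append)
  have "walk (a(letter l := t)) c (P @ l # A @ l # Q) d \<longleftrightarrow> t = arrow l p r" for t
    unfolding walk_same_iff[OF assms] using pr walk_functional[of a] by metis
  thus ?thesis using True by simp
next
  case False
  hence "\<not> walk (a(letter l := t)) c (P @ l # A @ l # Q) d" for t
    unfolding walk_same_iff[OF assms] by (auto simp only: walk_append)
  thus ?thesis using False by simp
qed

text \<open>\<open>p\<close> is forced, but the tip \<open>r\<close> of the folded arrow is
  constrained by no other letter: it is the vertex that disappears.\<close>

lemma card_walk_cancel:
  fixes a :: "nat \<Rightarrow> 'c \<times> 'c"
  assumes "letter l \<notin> letters (P @ Q)"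
  shows "card {t \<in> UNIV. walk (a(letter l := t)) c (P @ l # negate l # Q) d} =
    (if walk a c (P @ Q) d then CARD('c) else 0)"
proof (cases "walk a c (P @ Q) d")
  case True
  then obtain p where p: "walk a c P p" "walk a p Q d"
    by (auto simp only: walk_append)
  have "walk (a(letter l := t)) c (P @ l # negate l # Q) d \<longleftrightarrow> (\<exists>r. t = arrow l p r)" for t
    unfolding walk_cancel_iff[OF assms] using p walk_functional[of a] by metis
  hence "{t \<in> UNIV. walk (a(letter l := t)) c (P @ l # negate l # Q) d} = range (arrow l p)"
    by auto
  also have "card \<dots> = CARD('c)"
    by (rule card_image) (simp add: inj_on_def)
  finally show ?thesis using True by simp
next
  case False
  hence "\<not> walk (a(letter l := t)) c (P @ l # negate l # Q) d" for t
    unfolding walk_cancel_iff[OF assms] by (auto simp only: walk_append)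
  thus ?thesis using False by simp
qed

text \<open>With \<open>V\<close> the number of vertices of the surface glued from \<open>w\<close>, there are \<open>2 ^ (V - 1)\<close>
  of these: a vertex colouring in which the base vertex has colour \<open>c\<close>.\<close>

definition colourings :: "signed_nat list \<Rightarrow> bool \<Rightarrow> (nat \<Rightarrow> bool \<times> bool) set" where
  "colourings w c = {a \<in> letters w \<rightarrow>\<^sub>E UNIV. walk a c w c}"

lemma finite_colourings: "finite (colourings w c)"
  by (simp add: colourings_def finite_PiE)

lemma card_colourings_same:
  assumes "letter l \<notin> letters (P @ A @ Q)"
  shows "card (colourings (P @ l # A @ l # Q) c) = card (colourings (P @ word_inverse A @ Q) c)"
proof -
  have "letters (P @ l # A @ l # Q) = insert (letter l) (letters (P @ A @ Q))"
    by auto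
  hence "card (colourings (P @ l # A @ l # Q) c) =
      (\<Sum>a\<in>(letters (P @ A @ Q) \<rightarrow>\<^sub>E UNIV).
        card {t \<in> UNIV. walk (a(letter l := t)) c (P @ l # A @ l # Q) c})"
    unfolding colourings_def by (simp only: card_PiE_insert[OF _ _ assms] finite_letters finite)
  also have "\<dots> = card {a \<in> letters (P @ A @ Q) \<rightarrow>\<^sub>E UNIV. walk a c (P @ word_inverse A @ Q) c}"
    by (simp only: card_walk_same[OF assms] sum_if_card finite_PiE finite_letters finite mult_1)
  finally show ?thesis
    by (simp add: colourings_def)
qed

lemma card_colourings_cancel:
  assumes "letter l \<notin> letters (P @ Q)"
  shows "card (colourings (P @ l # negate l # Q) c) = 2 * card (colourings (P @ Q) c)"
proof -
  have "letters (P @ l # negate l # Q) = insert (letter l) (letters (P @ Q))"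
    by auto
  hence "card (colourings (P @ l # negate l # Q) c) =
      (\<Sum>a\<in>(letters (P @ Q) \<rightarrow>\<^sub>E UNIV).
        card {t \<in> UNIV. walk (a(letter l := t)) c (P @ l # negate l # Q) c})"
    unfolding colourings_def by (simp only: card_PiE_insert[OF _ _ assms] finite_letters finite)
  also have "\<dots> = 2 * card (colourings (P @ Q) c)"
    unfolding colourings_def
    by (simp only: card_walk_cancel[OF assms] sum_if_card finite_PiE finite_letters finite card_UNIV_bool)
  finally show ?thesis .
qed

text \<open>The factor \<open>A\<close> starts and ends at the tip of \<open>l\<close>, and a closed
  walk may be run backwards.\<close>

lemma walk_flip:
  "walk a c (P @ l # word_inverse A @ negate l # Q) d \<longleftrightarrow> walk a c (P @ l # A @ negate l # Q) d"
proof -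
  have "walk a r (word_inverse A) r \<longleftrightarrow> walk a r A r" for r
    by (simp only: walk_word_inverse)
  thus ?thesis by (simp add: walk_append)
qed

lemma colourings_flip:
  "colourings (P @ l # word_inverse A @ negate l # Q) c = colourings (P @ l # A @ negate l # Q) c"
  by (simp only: colourings_def walk_flip) simp

subsection \<open>Solutions of a word equation in a finite group\<close>

context group
begin

definition word_value :: "(nat \<Rightarrow> 'a) \<Rightarrow> signed_nat list \<Rightarrow> 'a" where
  "word_value a w = list_prod G (map (signed_value G a) w)"

lemma signed_value_closed [simp]:
  "a (letter l) \<in> carrier G \<Longrightarrow> signed_value G a l \<in> carrier G"
  by (cases l) auto

lemma word_value_Nil [simp]: "word_value a [] = \<one>"
  by (simp add: word_value_def list_prod_def)

lemma word_value_Cons [simp]: "word_value a (l # w) = signed_value G a l \<otimes> word_value a w"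
  by (simp add: word_value_def list_prod_def)

lemma word_value_closed [simp]:
  "a ` letters w \<subseteq> carrier G \<Longrightarrow> word_value a w \<in> carrier G"
  by (induction w) auto

lemma word_value_append:
  "a ` letters (u @ w) \<subseteq> carrier G \<Longrightarrow>
    word_value a (u @ w) = word_value a u \<otimes> word_value a w"
  by (induction u) (auto simp: m_assoc image_Un)

lemma word_value_word_inverse:
  "a ` letters w \<subseteq> carrier G \<Longrightarrow> word_value a (word_inverse w) = inv (word_value a w)"
proof (induction w)
  case (Cons l w)
  have "signed_value G a (negate l) = inv (signed_value G a l)"
    using Cons.prems by (cases l) auto
  thus ?case using Cons by (simp add: word_value_append inv_mult_group image_Un)
qed auto

lemma word_value_upd [simp]: "x \<notin> letters w \<Longrightarrow> word_value (a(x := t)) w = word_value a w"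
proof (induction w)
  case (Cons l w)
  thus ?case by (cases l) auto
qed auto

definition solutions :: "signed_nat list \<Rightarrow> 'a \<Rightarrow> (nat \<Rightarrow> 'a) set" where
  "solutions w g = {a \<in> letters w \<rightarrow>\<^sub>E carrier G. word_value a w = g}"

text \<open>The number of \<open>k\<close>-tuples whose squares multiply to \<open>g\<close>. For
  positive \<open>k\<close> these are the solutions for \<open>1 1 2 2 ... k k\<close>, the normal
  form of a nonorientable surface.\<close>

primrec square_products :: "nat \<Rightarrow> 'a \<Rightarrow> nat" where
  "square_products 0 g = (if g = \<one> then 1 else 0)"
| "square_products (Suc k) g =
     (\<Sum>h\<in>carrier G. square_products k h * card {s \<in> carrier G. s \<otimes> s = g \<otimes> inv h})"

text \<open>A negative \<open>l\<close> makes \<open>t\<close> enter through its inverse, and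
  inversion permutes the group, so the sign of \<open>l\<close> does not affect the count.\<close>

lemma card_signed_subst:
  "card {t \<in> carrier G. R (signed_value G (a(letter l := t)) l)} = card {t \<in> carrier G. R t}"
proof (cases l)
  case (Neg x)
  have "bij_betw (\<lambda>t. inv t) {t \<in> carrier G. R (inv t)} {t \<in> carrier G. R t}"
    by (rule bij_betw_byWitness[where f' = "\<lambda>t. inv t"]) auto
  thus ?thesis using Neg bij_betw_same_card by fastforce
qed auto

text \<open>\<open>m_assoc\<close> brackets to the right and so hides adjacent inverse factors from
  \<open>l_inv\<close> and \<open>r_inv\<close>; these forms find them.\<close>

lemma inv_cancel_left [simp]:
  assumes "x \<in> carrier G" "y \<in> carrier G"
  shows "inv x \<otimes> (x \<otimes> y) = y" "x \<otimes> (inv x \<otimes> y) = y"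
  using assms by (simp_all flip: m_assoc)

lemma solve_between:
  assumes "p \<in> carrier G" "y \<in> carrier G" "q \<in> carrier G" "g \<in> carrier G"
  shows "p \<otimes> (y \<otimes> q) = g \<longleftrightarrow> y = inv p \<otimes> g \<otimes> inv q"
  using assms by (auto simp: m_assoc)

text \<open>Substitute \<open>s = p t z p\<inverse>\<close>.\<close>

lemma card_square_subst:
  assumes p: "p \<in> carrier G" and z: "z \<in> carrier G" and q: "q \<in> carrier G" and g: "g \<in> carrier G"
  shows "card {t \<in> carrier G. p \<otimes> (t \<otimes> (z \<otimes> (t \<otimes> q))) = g} =
    card {s \<in> carrier G. s \<otimes> s = g \<otimes> inv (p \<otimes> (inv z \<otimes> q))}"
proof -
  let ?f = "\<lambda>t. p \<otimes> (t \<otimes> (z \<otimes> inv p))" and ?h = "\<lambda>s. inv p \<otimes> (s \<otimes> (p \<otimes> inv z))"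
  have iff: "?f t \<otimes> ?f t = g \<otimes> inv (p \<otimes> (inv z \<otimes> q)) \<longleftrightarrow> p \<otimes> (t \<otimes> (z \<otimes> (t \<otimes> q))) = g"
    if t: "t \<in> carrier G" for t
  proof -
    have "?f t \<otimes> ?f t \<otimes> (p \<otimes> (inv z \<otimes> q)) = p \<otimes> (t \<otimes> (z \<otimes> (t \<otimes> q)))"
      using p z q t by (simp add: m_assoc)
    thus ?thesis
      using p z q t g by (metis inv_closed inv_solve_right m_closed)
  qed
  have inverse: "?f (?h t) = t" "?h (?f t) = t" if "t \<in> carrier G" for t
    using that p z by (simp_all add: m_assoc)
  have "bij_betw ?f {t \<in> carrier G. p \<otimes> (t \<otimes> (z \<otimes> (t \<otimes> q))) = g}
      {s \<in> carrier G. s \<otimes> s = g \<otimes> inv (p \<otimes> (inv z \<otimes> q))}"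
  proof (rule bij_betw_byWitness[where f' = ?h])
    show "?h ` {s \<in> carrier G. s \<otimes> s = g \<otimes> inv (p \<otimes> (inv z \<otimes> q))} \<subseteq>
        {t \<in> carrier G. p \<otimes> (t \<otimes> (z \<otimes> (t \<otimes> q))) = g}"
    proof safe
      fix s assume s: "s \<in> carrier G" "s \<otimes> s = g \<otimes> inv (p \<otimes> (inv z \<otimes> q))"
      have h: "?h s \<in> carrier G" using s p z by simp
      thus "?h s \<in> carrier G" .
      show "p \<otimes> (?h s \<otimes> (z \<otimes> (?h s \<otimes> q))) = g"
        using iff[OF h, unfolded inverse(1)[OF s(1)] s(2)] by blast
    qed
  qed (use iff p z inverse in auto)
  thus ?thesis by (rule bij_betw_same_card)
qed


end

section \<open>Effect of the three moves on the number of solutions\<close>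

locale finite_group = group +
  assumes finite_carrier: "finite (carrier G)"
begin

lemma card_solutions_remove:
  assumes "letters w = insert x D" and "finite D" and "x \<notin> D"
  shows "card (solutions w g) =
    (\<Sum>a\<in>(D \<rightarrow>\<^sub>E carrier G). card {t \<in> carrier G. word_value (a(x := t)) w = g})"
  unfolding solutions_def assms(1)
  by (rule card_PiE_insert) (use assms finite_carrier in auto)

lemma word_value_two_occurrences:
  assumes "letter l \<notin> letters (P @ A @ Q)" and "letter k = letter l"
    and "t \<in> carrier G" and "a ` letters (P @ A @ Q) \<subseteq> carrier G"
  shows "word_value (a(letter l := t)) (P @ l # A @ k # Q) =
    word_value a P \<otimes> (signed_value G (a(letter l := t)) l \<otimes>
      (word_value a A \<otimes> (signed_value G (a(letter l := t)) k \<otimes> word_value a Q)))"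
proof -
  have "word_value b (P @ l # A @ k # Q) = word_value b P \<otimes> (signed_value G b l \<otimes>
      (word_value b A \<otimes> (signed_value G b k \<otimes> word_value b Q)))"
    if "b ` letters (P @ l # A @ k # Q) \<subseteq> carrier G" for b
    using that by (simp add: word_value_append image_Un)
  from this[of "a(letter l := t)"] show ?thesis
    using assms by auto
qed

text \<open>With the other letters fixed, the equation in \<open>t\<close> becomes
  \<open>s \<otimes> s = g \<otimes> inv h\<close>, where \<open>h\<close> is the value of the
  shortened word. The sum over \<open>h\<close> is the recursion of
  \<open>square_products\<close>.\<close>

lemma card_solutions_same:
  assumes l: "letter l \<notin> letters (P @ A @ Q)" and g: "g \<in> carrier G"
  shows "card (solutions (P @ l # A @ l # Q) g) =
    (\<Sum>h\<in>carrier G. card (solutions (P @ word_inverse A @ Q) h) *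
      card {s \<in> carrier G. s \<otimes> s = g \<otimes> inv h})"
proof -
  let ?D = "letters (P @ A @ Q)" and ?w = "P @ word_inverse A @ Q"
  let ?sq = "\<lambda>h. card {s \<in> carrier G. s \<otimes> s = g \<otimes> inv h}"
  have "letters (P @ l # A @ l # Q) = insert (letter l) ?D" by auto
  hence "card (solutions (P @ l # A @ l # Q) g) = (\<Sum>a\<in>(?D \<rightarrow>\<^sub>E carrier G).
      card {t \<in> carrier G. word_value (a(letter l := t)) (P @ l # A @ l # Q) = g})"
    by (rule card_solutions_remove) (use l in auto)
  also have "\<dots> = (\<Sum>a\<in>(?D \<rightarrow>\<^sub>E carrier G). ?sq (word_value a ?w))"
  proof (rule sum.cong[OF refl])
    fix a assume "a \<in> ?D \<rightarrow>\<^sub>E carrier G"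
    hence a: "a ` ?D \<subseteq> carrier G" by blast
    hence closed: "word_value a P \<in> carrier G" "word_value a A \<in> carrier G" "word_value a Q \<in> carrier G"
      using a by (simp_all add: image_Un)
    have "card {t \<in> carrier G. word_value (a(letter l := t)) (P @ l # A @ l # Q) = g} =
        card {t \<in> carrier G. word_value a P \<otimes> (signed_value G (a(letter l := t)) l \<otimes>
          (word_value a A \<otimes> (signed_value G (a(letter l := t)) l \<otimes> word_value a Q))) = g}"
      by (intro arg_cong[where f = card] Collect_cong conj_cong refl)
        (simp only: word_value_two_occurrences[OF l refl _ a])
    also have "\<dots> = card {t \<in> carrier G. word_value a P \<otimes> (t \<otimes>
          (word_value a A \<otimes> (t \<otimes> word_value a Q))) = g}"
      by (rule card_signed_subst)
    also have "\<dots> = ?sq (word_value a P \<otimes> (inv word_value a A \<otimes> word_value a Q))"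
      by (rule card_square_subst) (use closed g in auto)
    also have "word_value a P \<otimes> (inv word_value a A \<otimes> word_value a Q) = word_value a ?w"
      using a by (simp add: word_value_append word_value_word_inverse image_Un)
    finally show "card {t \<in> carrier G. word_value (a(letter l := t)) (P @ l # A @ l # Q) = g} =
      ?sq (word_value a ?w)" .
  qed
  \<comment> \<open>Sort the assignments by the value \<open>h\<close> of the shortened
    word.\<close>
  also have "\<dots> = (\<Sum>h\<in>carrier G. \<Sum>a | a \<in> ?D \<rightarrow>\<^sub>E carrier G \<and> word_value a ?w = h.
      ?sq (word_value a ?w))"
  proof (rule sum.group[symmetric])
    show "(\<lambda>a. word_value a ?w) ` (?D \<rightarrow>\<^sub>E carrier G) \<subseteq> carrier G"
    proof (rule image_subsetI, rule word_value_closed)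
      fix a assume "a \<in> ?D \<rightarrow>\<^sub>E carrier G"
      thus "a ` letters ?w \<subseteq> carrier G" by auto
    qed
  qed (simp_all add: finite_PiE finite_carrier)
  also have "\<dots> = (\<Sum>h\<in>carrier G. card (solutions ?w h) * ?sq h)"
    by (rule sum.cong[OF refl]) (simp add: solutions_def)
  finally show ?thesis .
qed

text \<open>The letter cancels from the product, so each of its values is allowed once the rest is a
  solution.\<close>

lemma card_solutions_cancel:
  assumes l: "letter l \<notin> letters (P @ Q)"
  shows "card (solutions (P @ l # negate l # Q) g) = card (carrier G) * card (solutions (P @ Q) g)"
proof -
  let ?D = "letters (P @ Q)"
  have "letters (P @ l # negate l # Q) = insert (letter l) ?D" by auto
  hence "card (solutions (P @ l # negate l # Q) g) = (\<Sum>a\<in>(?D \<rightarrow>\<^sub>E carrier G).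
      card {t \<in> carrier G. word_value (a(letter l := t)) (P @ l # negate l # Q) = g})"
    by (rule card_solutions_remove) (use l in auto)
  also have "\<dots> = (\<Sum>a\<in>(?D \<rightarrow>\<^sub>E carrier G). if word_value a (P @ Q) = g then card (carrier G) else 0)"
  proof (rule sum.cong[OF refl])
    fix a assume "a \<in> ?D \<rightarrow>\<^sub>E carrier G"
    hence a: "a ` ?D \<subseteq> carrier G" by blast
    \<comment> \<open>\<open>[]\<close> is the empty factor between the two occurrences, so that
      \<open>word_value_two_occurrences\<close> applies.\<close>
    have "word_value (a(letter l := t)) (P @ l # [] @ negate l # Q) = word_value a (P @ Q)"
      if t: "t \<in> carrier G" for t
    proof -
      have "signed_value G (a(letter l := t)) (negate l) = inv signed_value G (a(letter l := t)) l"
        using t by (cases l) auto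
      thus ?thesis
        using a t l by (subst word_value_two_occurrences) (auto simp: word_value_append image_Un)
    qed
    thus "card {t \<in> carrier G. word_value (a(letter l := t)) (P @ l # negate l # Q) = g} =
        (if word_value a (P @ Q) = g then card (carrier G) else 0)"
      by (auto cong: conj_cong)
  qed
  also have "\<dots> = card (carrier G) * card (solutions (P @ Q) g)"
    unfolding solutions_def
    by (simp only: sum_if_card finite_PiE finite_letters finite_carrier)
  finally show ?thesis .
qed

text \<open>As \<open>h\<close> conjugates \<open>z\<close> to \<open>z'\<close>, conjugating
  \<open>z'\<close> by \<open>t\<close> is conjugating \<open>z\<close> by
  \<open>t \<otimes> h\<close>; right translation by \<open>h\<close> matches the two sets.\<close>

lemma card_conjugator_subst:
  assumes "h \<in> carrier G" "z \<in> carrier G" "h \<otimes> z \<otimes> inv h = z'"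
  shows "card {t \<in> carrier G. t \<otimes> z' \<otimes> inv t = g} = card {t \<in> carrier G. t \<otimes> z \<otimes> inv t = g}"
proof -
  have "t \<otimes> h \<otimes> z \<otimes> inv (t \<otimes> h) = t \<otimes> z' \<otimes> inv t" if "t \<in> carrier G" for t
    using that assms(1,2) unfolding assms(3)[symmetric] by (simp add: m_assoc inv_mult_group)
  moreover have "t \<otimes> inv h \<otimes> z' \<otimes> inv (t \<otimes> inv h) = t \<otimes> z \<otimes> inv t" if "t \<in> carrier G" for t
    using that assms(1,2) unfolding assms(3)[symmetric] by (simp add: m_assoc inv_mult_group)
  ultimately have "bij_betw (\<lambda>t. t \<otimes> h) {t \<in> carrier G. t \<otimes> z' \<otimes> inv t = g}
      {t \<in> carrier G. t \<otimes> z \<otimes> inv t = g}"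
    using assms(1) by (intro bij_betw_byWitness[where f' = "\<lambda>t. t \<otimes> inv h"]) (auto simp: m_assoc)
  thus ?thesis by (rule bij_betw_same_card)
qed

text \<open>With the other letters fixed, the free letter has to conjugate the value of
  \<open>A\<close> to a given element. The number of ways depends only on the conjugacy class of
  that value, and ambivalence puts its inverse into the same class.\<close>

lemma card_solutions_flip:
  assumes amb: "ambivalent G" and l: "letter l \<notin> letters (P @ A @ Q)" and g: "g \<in> carrier G"
  shows "card (solutions (P @ l # word_inverse A @ negate l # Q) g) =
    card (solutions (P @ l # A @ negate l # Q) g)"
proof -
  let ?D = "letters (P @ A @ Q)"
  \<comment> \<open>Stated for every \<open>B\<close> on the letters of \<open>A\<close>, to be used
    for both \<open>A\<close> and its inverse.\<close>
  have count: "card {t \<in> carrier G. word_value (a(letter l := t)) (P @ l # B @ negate l # Q) = g} =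
      card {t \<in> carrier G. t \<otimes> word_value a B \<otimes> inv t = inv word_value a P \<otimes> g \<otimes> inv word_value a Q}"
    if a: "a ` ?D \<subseteq> carrier G" and B: "letters B = letters A" for a B
  proof -
    let ?p = "word_value a P" and ?z = "word_value a B" and ?q = "word_value a Q"
    let ?s = "\<lambda>t. signed_value G (a(letter l := t)) l"
    have closed: "?p \<in> carrier G" "?z \<in> carrier G" "?q \<in> carrier G"
      using a B by (simp_all add: image_Un)
    have "word_value (a(letter l := t)) (P @ l # B @ negate l # Q) = g \<longleftrightarrow>
        ?s t \<otimes> ?z \<otimes> inv ?s t = inv ?p \<otimes> g \<otimes> inv ?q" if t: "t \<in> carrier G" for t
    proof -
      have s: "?s t \<in> carrier G" using t by simp
      have "signed_value G (a(letter l := t)) (negate l) = inv ?s t"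
        using t by (cases l) auto
      hence "word_value (a(letter l := t)) (P @ l # B @ negate l # Q) =
          ?p \<otimes> (?s t \<otimes> ?z \<otimes> inv ?s t \<otimes> ?q)"
        using a t l B s closed by (subst word_value_two_occurrences) (auto simp: m_assoc)
      thus ?thesis
        using closed g s by (simp add: solve_between)
    qed
    hence "card {t \<in> carrier G. word_value (a(letter l := t)) (P @ l # B @ negate l # Q) = g} =
        card {t \<in> carrier G. ?s t \<otimes> ?z \<otimes> inv ?s t = inv ?p \<otimes> g \<otimes> inv ?q}"
      by (intro arg_cong[where f = card]) auto
    also have "\<dots> = card {t \<in> carrier G. t \<otimes> ?z \<otimes> inv t = inv ?p \<otimes> g \<otimes> inv ?q}"
      by (rule card_signed_subst)
    finally show ?thesis .
  qed
  have "card (solutions (P @ l # B @ negate l # Q) g) = (\<Sum>a\<in>(?D \<rightarrow>\<^sub>E carrier G). card {t \<in> carrier G.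
      t \<otimes> word_value a B \<otimes> inv t = inv word_value a P \<otimes> g \<otimes> inv word_value a Q})"
    if B: "letters B = letters A" for B
  proof -
    have "letters (P @ l # B @ negate l # Q) = insert (letter l) ?D" using B by auto
    hence "card (solutions (P @ l # B @ negate l # Q) g) = (\<Sum>a\<in>(?D \<rightarrow>\<^sub>E carrier G).
        card {t \<in> carrier G. word_value (a(letter l := t)) (P @ l # B @ negate l # Q) = g})"
      by (rule card_solutions_remove) (use l in auto)
    also have "\<dots> = (\<Sum>a\<in>(?D \<rightarrow>\<^sub>E carrier G). card {t \<in> carrier G.
      t \<otimes> word_value a B \<otimes> inv t = inv word_value a P \<otimes> g \<otimes> inv word_value a Q})"
      by (rule sum.cong[OF refl], rule count[OF _ B]) blast
    finally show ?thesis .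
  qed
  note expand = this
  have "card {t \<in> carrier G. t \<otimes> word_value a (word_inverse A) \<otimes> inv t = y} =
      card {t \<in> carrier G. t \<otimes> word_value a A \<otimes> inv t = y}" if "a \<in> ?D \<rightarrow>\<^sub>E carrier G" for a y
  proof -
    have a: "a ` letters A \<subseteq> carrier G" using that by auto
    hence "word_value a A \<in> carrier G" by simp
    then obtain h where "h \<in> carrier G" "h \<otimes> word_value a A \<otimes> inv h = inv word_value a A"
      using amb unfolding ambivalent_def by blast
    with \<open>word_value a A \<in> carrier G\<close> show ?thesis
      using a by (simp add: word_value_word_inverse card_conjugator_subst)
  qed
  thus ?thesis
    unfolding expand[OF letters_word_inverse] expand[OF refl] by (intro sum.cong) auto
qed

text \<open>The exponent \<open>v\<close> is the number of vertices other than the base vertex.\<close>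

definition determined :: "signed_nat list \<Rightarrow> bool" where
  "determined w \<longleftrightarrow> (\<exists>v\<le>card (letters w).
     (\<forall>c. card (colourings w c) = 2 ^ v) \<and>
     (\<forall>g\<in>carrier G. card (solutions w g) = card (carrier G) ^ v * square_products (card (letters w) - v) g))"

lemma determined_Nil: "determined []"
proof -
  have "solutions [] g = (if g = \<one> then {\<lambda>_. undefined} else {})" for g
    by (auto simp: solutions_def)
  moreover have "colourings [] c = {\<lambda>_. undefined}" for c
    by (auto simp: colourings_def)
  ultimately show ?thesis by (simp add: determined_def)
qed

text \<open>One letter more and the same \<open>v\<close>: the extra letter is the extra square in
  \<open>square_products\<close>.\<close>

lemma determined_same:
  assumes l: "letter l \<notin> letters (P @ A @ Q)" and det: "determined (P @ word_inverse A @ Q)"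
  shows "determined (P @ l # A @ l # Q)"
proof -
  let ?n = "card (letters (P @ A @ Q))"
  have "letters (P @ l # A @ l # Q) = insert (letter l) (letters (P @ A @ Q))" by auto
  hence n: "card (letters (P @ l # A @ l # Q)) = Suc ?n"
    using l by simp
  have "letters (P @ word_inverse A @ Q) = letters (P @ A @ Q)" by simp
  with det obtain v where v: "v \<le> ?n" "\<And>c. card (colourings (P @ word_inverse A @ Q) c) = 2 ^ v"
    "\<And>g. g \<in> carrier G \<Longrightarrow> card (solutions (P @ word_inverse A @ Q) g) =
      card (carrier G) ^ v * square_products (?n - v) g"
    unfolding determined_def by metis
  have "card (solutions (P @ l # A @ l # Q) g) = card (carrier G) ^ v * square_products (Suc ?n - v) g"
    if "g \<in> carrier G" for g
    using v that by (simp add: card_solutions_same[OF l] Suc_diff_le sum_distrib_left mult.assoc)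
  thus ?thesis
    unfolding determined_def n using v(1,2) card_colourings_same[OF l] by (metis le_SucI)
qed

text \<open>Letters and \<open>v\<close> both grow by one, so the number of squares stays, while the
  powers of \<open>2\<close> and of \<open>card (carrier G)\<close> gain one factor each.\<close>

lemma determined_cancel:
  assumes l: "letter l \<notin> letters (P @ Q)" and det: "determined (P @ Q)"
  shows "determined (P @ l # negate l # Q)"
proof -
  let ?n = "card (letters (P @ Q))"
  have n: "card (letters (P @ l # negate l # Q)) = Suc ?n"
    using l by simp
  from det obtain v where v: "v \<le> ?n" "\<And>c. card (colourings (P @ Q) c) = 2 ^ v"
    "\<And>g. g \<in> carrier G \<Longrightarrow> card (solutions (P @ Q) g) = card (carrier G) ^ v * square_products (?n - v) g"
    unfolding determined_def by metis
  show ?thesis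
    unfolding determined_def n
    using v l by (intro exI[of _ "Suc v"]) (simp add: card_colourings_cancel card_solutions_cancel)
qed

lemma determined_flip:
  assumes "ambivalent G" and "letter l \<notin> letters (P @ A @ Q)"
    and "determined (P @ l # word_inverse A @ negate l # Q)"
  shows "determined (P @ l # A @ negate l # Q)"
proof -
  have "letters (P @ l # word_inverse A @ negate l # Q) = letters (P @ l # A @ negate l # Q)"
    by simp
  moreover have "(\<forall>g\<in>carrier G. card (solutions (P @ l # word_inverse A @ negate l # Q) g) = f g) \<longleftrightarrow>
      (\<forall>g\<in>carrier G. card (solutions (P @ l # A @ negate l # Q) g) = f g)" for f
    using card_solutions_flip[OF assms(1,2)] by simp
  ultimately show ?thesis
    using assms(3) by (simp only: determined_def colourings_flip)
qed

text \<open>Induction on the length. A letter occurring twice with one sign is removed as a square.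
  Otherwise a pair \<open>l A negate l\<close> with shortest \<open>A\<close> is chosen: an empty
  \<open>A\<close> cancels; a nonempty one is flipped, which gives its first letter a partner of
  equal sign, so that a square can be removed after all.\<close>

lemma determined_double_word:
  assumes amb: "ambivalent G"
  shows "double_word w \<Longrightarrow> determined w"
proof (induction "length w" arbitrary: w rule: less_induct)
  case less
  \<comment> \<open>Stated for all words as long as \<open>w\<close>, because it must also apply to
    the flipped word, which is not shorter.\<close>
  have same: "determined u" if u: "u = P @ l # A @ l # Q" "length u = length w" "double_word u"
    for u P l A Q
  proof -
    have d: "double_word (P @ l # A @ l # Q)" using u by simp
    have "double_word (P @ word_inverse A @ Q)"
      by (rule double_word_removeD[OF d refl]) simp
    moreover have "length (P @ word_inverse A @ Q) < length w"
      using u(1) unfolding u(2)[symmetric] by simp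
    ultimately have "determined (P @ word_inverse A @ Q)"
      using less.hyps by blast
    thus ?thesis
      unfolding u(1) by (rule determined_same[OF double_wordD[OF d refl]])
  qed
  show ?case
  proof (cases "w = [] \<or> (\<exists>P l A Q. w = P @ l # A @ l # Q)")
    case True
    thus ?thesis using same less.prems determined_Nil by blast
  next
    case False
    hence opposite: "w \<noteq> P @ l # A @ l # Q" for P l A Q by blast
    let ?R = "\<lambda>m. \<exists>P l A Q. w = P @ l # A @ negate l # Q \<and> length A = m"
    have "\<exists>m. ?R m"
    proof -
      from False obtain l V where w: "w = [] @ l # V" by (cases w) auto
      hence "letter l \<in> letters V"
        using double_word_ex_partner[of "[]" l V] less.prems by simp
      then obtain A k Q where "V = A @ k # Q" "k = l \<or> k = negate l"
        by (rule letters_split)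
      thus ?thesis using w opposite by blast
    qed
    then obtain m where "?R m" and min: "\<And>m'. m' < m \<Longrightarrow> \<not> ?R m'"
      using exists_least_iff[of ?R] by blast
    then obtain P l A Q where w: "w = P @ l # A @ negate l # Q" and m: "length A = m" by blast
    have d: "double_word (P @ l # A @ negate l # Q)" using less.prems w by simp
    have l: "letter l \<notin> letters (P @ A @ Q)"
      using double_wordD[OF d] by simp
    show ?thesis
    proof (cases A)
      case Nil
      have "double_word (P @ Q)"
        by (rule double_word_removeD[OF d]) (simp_all add: Nil)
      hence "determined (P @ Q)"
        using less.hyps w by simp
      thus ?thesis
        using determined_cancel[of l P Q] l by (simp add: w Nil)
    next
      case (Cons b A')
      let ?u = "P @ l # word_inverse A @ negate l # Q"
      have u: "length ?u = length w" "double_word ?u"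
        by (simp add: w) (rule double_word_cong[OF less.prems], simp add: w)
      have "w = (P @ [l]) @ b # (A' @ negate l # Q)"
        by (simp add: w Cons)
      hence "letter b \<in> letters ((P @ [l]) @ (A' @ negate l # Q))"
        using less.prems double_word_ex_partner by metis
      moreover have "letter b \<noteq> letter l" using l by (auto simp: Cons)
      ultimately consider "letter b \<in> letters P" | "letter b \<in> letters A'" | "letter b \<in> letters Q"
        by auto
      \<comment> \<open>The partner of \<open>b\<close> is not in \<open>A'\<close>, where it would
        form a pair closer than \<open>m\<close>. Elsewhere it is \<open>negate b\<close>, and the
        flip turns \<open>b\<close> itself into \<open>negate b\<close>.\<close>
      hence "determined ?u"
      proof cases
        case 1
        then obtain P1 k P2 where P: "P = P1 @ k # P2" "k = b \<or> k = negate b"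
          by (rule letters_split)
        moreover have "k \<noteq> b"
          using opposite[of P1 b "P2 @ [l]"] P(1) by (auto simp: w Cons)
        ultimately have "?u = P1 @ negate b # (P2 @ l # word_inverse A') @ negate b # negate l # Q"
          by (simp add: Cons)
        thus ?thesis using same u by blast
      next
        case 2
        then obtain A1 k A2 where A': "A' = A1 @ k # A2" "k = b \<or> k = negate b"
          by (rule letters_split)
        moreover have "k \<noteq> b"
          using opposite[of "P @ [l]" b A1] A'(1) by (auto simp: w Cons)
        ultimately have "w = (P @ [l]) @ b # A1 @ negate b # (A2 @ negate l # Q)"
          by (simp add: w Cons)
        hence "?R (length A1)" by blast
        moreover have "length A1 < m" using m by (simp add: Cons A'(1))
        ultimately show ?thesis using min by blast
      next
        case 3
        then obtain Q1 k Q2 where Q: "Q = Q1 @ k # Q2" "k = b \<or> k = negate b"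
          by (rule letters_split)
        moreover have "k \<noteq> b"
          using opposite[of "P @ [l]" b "A' @ negate l # Q1"] Q(1) by (auto simp: w Cons)
        ultimately have "?u = (P @ l # word_inverse A') @ negate b # (negate l # Q1) @ negate b # Q2"
          by (simp add: Cons)
        thus ?thesis using same u by blast
      qed
      thus ?thesis
        unfolding w by (rule determined_flip[OF amb l])
    qed
  qed
qed

end

subsection \<open>Alternating cycles of two perfect matchings\<close>

text \<open>A perfect matching is encoded as the fixed point free involution that sends each vertex
  to its partner; \<open>g\<close> is gray and \<open>b\<close> black.\<close>

locale two_matchings =
  fixes H :: "signed_nat set" and g b :: "signed_nat \<Rightarrow> signed_nat"
  assumes finite_H: "finite H"
    and g_in: "v \<in> H \<Longrightarrow> g v \<in> H" and b_in: "v \<in> H \<Longrightarrow> b v \<in> H"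
    and g_g: "v \<in> H \<Longrightarrow> g (g v) = v" and b_b: "v \<in> H \<Longrightarrow> b (b v) = v"
    and g_neq: "v \<in> H \<Longrightarrow> g v \<noteq> v" and b_neq: "v \<in> H \<Longrightarrow> b v \<noteq> v"
begin

definition edges :: "signed_nat set \<Rightarrow> (colour \<times> signed_nat set) set" where
  "edges U = {(Gray, {v, g v}) | v. v \<in> U} \<union> {(Black, {v, b v}) | v. v \<in> U}"

text \<open>The step taken at position \<open>k\<close> of an alternating walk that begins with a
  gray edge.\<close>

definition mate :: "nat \<Rightarrow> signed_nat \<Rightarrow> signed_nat" where
  "mate k = (if even k then g else b)"

text \<open>The unions of cycles, or equivalently the Boolean vertex functions constant along every
  edge. For \<open>s\<close> cycles there are \<open>2 ^ s\<close> of them, which links the graph to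
  \<open>colourings\<close>.\<close>

definition closed_set :: "signed_nat set \<Rightarrow> bool" where
  "closed_set U \<longleftrightarrow> U \<subseteq> H \<and> (\<forall>v\<in>H. (g v \<in> U \<longleftrightarrow> v \<in> U) \<and> (b v \<in> U \<longleftrightarrow> v \<in> U))"

definition cycle :: "signed_nat list \<Rightarrow> bool" where
  "cycle vs \<longleftrightarrow> vs \<noteq> [] \<and> even (length vs) \<and> distinct vs \<and> closed_walk_edges vs \<subseteq> edges H"

lemma mate_in: "v \<in> H \<Longrightarrow> mate k v \<in> H"
  and mate_mate: "v \<in> H \<Longrightarrow> mate k (mate k v) = v"
  and mate_neq: "v \<in> H \<Longrightarrow> mate k v \<noteq> v"
  by (simp_all add: mate_def g_in b_in g_g b_b g_neq b_neq)

lemma mate_cong: "even k = even j \<Longrightarrow> mate k = mate j"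
  by (simp add: mate_def)

lemma edges_iff:
  assumes "U \<subseteq> H" and "\<And>v. v \<in> U \<Longrightarrow> g v \<in> U" and "\<And>v. v \<in> U \<Longrightarrow> b v \<in> U"
  shows "(if even k then Gray else Black, {u, v}) \<in> edges U \<longleftrightarrow> u \<in> U \<and> v = mate k u"
  using assms g_g b_b by (auto simp: edges_def mate_def doubleton_eq_iff subset_iff)

lemma cycle_step:
  assumes "cycle vs" and "k < length vs"
  shows "vs ! k \<in> H" "vs ! (Suc k mod length vs) = mate k (vs ! k)"
proof -
  have "(if even k then Gray else Black, {vs ! k, vs ! (Suc k mod length vs)}) \<in> edges H"
    using assms unfolding cycle_def closed_walk_edges_def by blast
  thus "vs ! k \<in> H" "vs ! (Suc k mod length vs) = mate k (vs ! k)"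
    using edges_iff[OF order_refl g_in b_in] by blast+
qed

lemma cycle_subset: "cycle vs \<Longrightarrow> set vs \<subseteq> H"
  using cycle_step(1) by (auto simp: in_set_conv_nth)

text \<open>The edge of the required colour at \<open>vs ! k\<close> is the one by which the cycle
  either leaves or enters. Only the vertex set is compared, because the entering edge is listed from
  its other end.\<close>

lemma cycle_mate:
  assumes "cycle vs" and "k < length vs"
  obtains i where "i < length vs" "even i = even j" "{vs ! k, mate j (vs ! k)} = {vs ! i, mate i (vs ! i)}"
proof (cases "even k = even j")
  case True
  thus ?thesis using that[of k] assms(2) mate_cong[OF True] by simp
next
  case False
  \<comment> \<open>The cyclic predecessor of \<open>k\<close>; as the length is even, parity
    alternates across the wrap-around too.\<close>
  define i where "i = (if k = 0 then length vs - 1 else k - 1)"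
  have len: "even (length vs)" "0 < length vs" using assms(1) by (auto simp: cycle_def)
  hence i: "i < length vs" "even i = even j" "Suc i mod length vs = k"
    using assms(2) False by (auto simp: i_def)
  have "vs ! k = mate i (vs ! i)"
    using cycle_step(2)[OF assms(1) i(1)] i(3) by simp
  moreover from this have "mate j (vs ! k) = vs ! i"
    using mate_cong[OF i(2)] mate_mate cycle_step(1)[OF assms(1) i(1)] by simp
  ultimately have "{vs ! k, mate j (vs ! k)} = {vs ! i, mate i (vs ! i)}" by auto
  thus ?thesis by (rule that[OF i(1,2)])
qed

lemma cycle_mate_in:
  assumes "cycle vs" and "v \<in> set vs"
  shows "mate j v \<in> set vs"
proof -
  obtain k where k: "k < length vs" "v = vs ! k"
    using assms(2) by (auto simp: in_set_conv_nth)
  obtain i where i: "i < length vs" "{vs ! k, mate j (vs ! k)} = {vs ! i, mate i (vs ! i)}"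
    by (rule cycle_mate[OF assms(1) k(1)]) blast
  have "mate i (vs ! i) = vs ! (Suc i mod length vs)"
    using cycle_step(2)[OF assms(1) i(1)] by simp
  also have "\<dots> \<in> set vs"
    by (rule nth_mem, rule mod_less_divisor) (use i(1) in linarith)
  finally have "{vs ! i, mate i (vs ! i)} \<subseteq> set vs"
    using i(1) by simp
  thus ?thesis unfolding i(2)[symmetric] k(2) by simp
qed

text \<open>One direction of invariance suffices, as the mates are involutions.\<close>

lemma closed_setI:
  assumes "U \<subseteq> H" and "\<And>j v. v \<in> U \<Longrightarrow> mate j v \<in> U"
  shows "closed_set U"
proof -
  have "mate j v \<in> U \<longleftrightarrow> v \<in> U" if "v \<in> H" for j v
    using assms(2) mate_mate[OF that] by metis
  from this[of _ 0] this[of _ 1] assms(1) show ?thesis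
    by (simp add: closed_set_def mate_def)
qed

lemma closed_setD: "closed_set U \<Longrightarrow> v \<in> H \<Longrightarrow> mate k v \<in> U \<longleftrightarrow> v \<in> U"
  by (simp add: closed_set_def mate_def)

lemma closed_set_cycle: "cycle vs \<Longrightarrow> closed_set (set vs)"
  by (rule closed_setI[OF cycle_subset cycle_mate_in])

text \<open>Membership in \<open>U\<close> is passed on along the edges of the cycle, hence is the
  same for all its vertices.\<close>

lemma cycle_minimal:
  assumes "cycle vs" and "closed_set U" and "v \<in> set vs" and "v \<in> U"
  shows "set vs \<subseteq> U"
proof -
  have iff: "vs ! k \<in> U \<longleftrightarrow> vs ! 0 \<in> U" if "k < length vs" for k
    using that
  proof (induction k)
    case (Suc k)
    hence "vs ! Suc k = mate k (vs ! k)" "vs ! k \<in> H"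
      using cycle_step[OF assms(1), of k] by simp_all
    thus ?case using Suc closed_setD[OF assms(2)] by simp
  qed simp
  thus ?thesis using assms(3,4) by (metis in_set_conv_nth subsetI)
qed

lemma edges_iff_mate:
  "e \<in> edges U \<longleftrightarrow> (\<exists>j. \<exists>v\<in>U. e = (if even j then Gray else Black, {v, mate j v}))"
proof
  assume "e \<in> edges U"
  then consider v where "v \<in> U" "e = (Gray, {v, g v})" | v where "v \<in> U" "e = (Black, {v, b v})"
    by (auto simp: edges_def)
  thus "\<exists>j. \<exists>v\<in>U. e = (if even j then Gray else Black, {v, mate j v})"
  proof cases
    case 1
    thus ?thesis by (intro exI[of _ 0]) (auto simp: mate_def)
  next
    case 2
    thus ?thesis by (intro exI[of _ 1]) (auto simp: mate_def)
  qed
next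
  assume "\<exists>j. \<exists>v\<in>U. e = (if even j then Gray else Black, {v, mate j v})"
  then obtain j v where "v \<in> U" "e = (if even j then Gray else Black, {v, mate j v})" by blast
  thus "e \<in> edges U"
    by (cases "even j") (auto simp only: edges_def mate_def if_True if_False)
qed

text \<open>A cycle uses the edges of both colours at each of its vertices, so its vertex set
  determines its edges.\<close>

lemma closed_walk_edges_cycle:
  assumes "cycle vs"
  shows "closed_walk_edges vs = edges (set vs)"
proof -
  let ?e = "\<lambda>k. (if even k then Gray else Black, {vs ! k, mate k (vs ! k)})"
  have "closed_walk_edges vs = ?e ` {..<length vs}"
    unfolding closed_walk_edges_def using cycle_step(2)[OF assms] by (intro image_cong) auto
  also have "\<dots> = edges (set vs)"
  proof
    show "?e ` {..<length vs} \<subseteq> edges (set vs)"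
    proof (rule image_subsetI)
      fix k assume "k \<in> {..<length vs}"
      thus "?e k \<in> edges (set vs)"
        unfolding edges_iff_mate by (intro exI[of _ k] bexI[of _ "vs ! k"]) simp_all
    qed
    show "edges (set vs) \<subseteq> ?e ` {..<length vs}"
    proof
      fix e assume "e \<in> edges (set vs)"
      then obtain j v where "v \<in> set vs" "e = (if even j then Gray else Black, {v, mate j v})"
        by (auto simp only: edges_iff_mate)
      then obtain k where k: "k < length vs"
        "e = (if even j then Gray else Black, {vs ! k, mate j (vs ! k)})"
        by (auto simp: in_set_conv_nth)
      obtain i where "i < length vs" "even i = even j"
        "{vs ! k, mate j (vs ! k)} = {vs ! i, mate i (vs ! i)}"
        by (rule cycle_mate[OF assms k(1)])
      thus "e \<in> ?e ` {..<length vs}"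
        unfolding k(2) by (intro image_eqI[of _ _ i]) simp_all
    qed
  qed
  finally show ?thesis .
qed

text \<open>A left inverse of \<open>edges\<close>, which makes it injective on closed sets.\<close>

lemma Union_edges: "closed_set U \<Longrightarrow> \<Union> (snd ` edges U) = U"
proof (intro equalityI subsetI)
  fix v assume U: "closed_set U" and "v \<in> \<Union> (snd ` edges U)"
  then obtain e where "e \<in> edges U" "v \<in> snd e" by blast
  then obtain j u where "u \<in> U" "v \<in> {u, mate j u}" by (auto simp only: edges_iff_mate snd_conv)
  thus "v \<in> U" using U closed_setD[OF U, of u j] by (auto simp: closed_set_def)
next
  fix v assume "v \<in> U"
  hence "(Gray, {v, g v}) \<in> edges U" by (auto simp: edges_def)
  thus "v \<in> \<Union> (snd ` edges U)" by force
qed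

primrec zigzag :: "signed_nat \<Rightarrow> nat \<Rightarrow> signed_nat" where
  "zigzag v 0 = v"
| "zigzag v (Suc k) = mate k (zigzag v k)"

lemma zigzag_in: "v \<in> H \<Longrightarrow> zigzag v k \<in> H"
  by (induction k) (auto simp: mate_in)

text \<open>Equal vertices at positions of different parity would be squeezed together from both sides
  until some vertex is its own mate.\<close>

lemma zigzag_odd_neq:
  assumes "v \<in> H"
  shows "zigzag v i \<noteq> zigzag v (i + 2 * d + 1)"
proof (induction d arbitrary: i)
  case 0
  show ?case using mate_neq[OF zigzag_in[OF assms], of i i] by simp
next
  case (Suc d)
  show ?case
  proof
    assume eq: "zigzag v i = zigzag v (i + 2 * Suc d + 1)"
    have "zigzag v (Suc i) = mate i (zigzag v (Suc (i + 2 * d + 2)))"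
      using eq by (simp add: add.assoc)
    also have "mate i = mate (i + 2 * d + 2)" by (rule mate_cong) simp
    also have "mate (i + 2 * d + 2) (zigzag v (Suc (i + 2 * d + 2))) = zigzag v (i + 2 * d + 2)"
      by (simp only: zigzag.simps mate_mate[OF zigzag_in[OF assms]])
    finally show False using Suc[of "Suc i"] by simp
  qed
qed

text \<open>Positions of equal parity use the same matching, so the last steps on both sides can be
  undone until the left index is \<open>0\<close>.\<close>

lemma zigzag_even_eq:
  assumes "v \<in> H" and "zigzag v i = zigzag v (i + 2 * d)"
  shows "zigzag v (2 * d) = v"
  using assms(2)
proof (induction i)
  case (Suc i)
  have "mate i = mate (i + 2 * d)" by (rule mate_cong) simp
  hence "mate i (zigzag v i) = mate i (zigzag v (i + 2 * d))"
    using Suc.prems by simp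
  hence "zigzag v i = zigzag v (i + 2 * d)"
    using mate_mate[OF zigzag_in[OF assms(1)]] by metis
  thus ?case by (rule Suc.IH)
qed simp

text \<open>By finiteness the alternating walk from \<open>v\<close> repeats a vertex, hence returns
  to \<open>v\<close>; the first return closes a cycle.\<close>

lemma ex_cycle:
  assumes v: "v \<in> H"
  obtains vs where "cycle vs" "v \<in> set vs"
proof -
  have parity: "even (j - i) \<and> zigzag v (j - i) = v" if "zigzag v i = zigzag v j" "i < j" for i j
  proof (cases "even (j - i)")
    case True
    then obtain d where "j - i = 2 * d" by blast
    moreover from this have "j = i + 2 * d" using that(2) by simp
    ultimately show ?thesis using zigzag_even_eq[OF v] that(1) by simp
  next
    case False
    then obtain d where "j - i = 2 * d + 1" by (elim oddE)
    hence "j = i + 2 * d + 1" using that(2) by simp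
    thus ?thesis using zigzag_odd_neq[OF v] that(1) by simp
  qed
  let ?R = "\<lambda>L. 0 < L \<and> zigzag v L = v"
  have "\<not> inj (zigzag v)"
    using finite_H finite_subset[of "range (zigzag v)" H] zigzag_in[OF v] infinite_UNIV_nat
    by (auto dest: finite_imageD)
  then obtain i j where "zigzag v i = zigzag v j" "i < j"
    by (metis injI linorder_neqE_nat)
  hence "\<exists>L. ?R L" using parity by (metis zero_less_diff)
  then obtain L where L: "0 < L" "zigzag v L = v" and min: "\<And>L'. L' < L \<Longrightarrow> \<not> ?R L'"
    using exists_least_iff[of ?R] by blast
  have "even L" using parity[of 0 L] L by simp
  \<comment> \<open>An earlier repetition would give an earlier return to \<open>v\<close>.\<close>
  have "inj_on (zigzag v) {..<L}"
  proof (rule linorder_inj_onI')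
    fix i j assume "i \<in> {..<L}" "j \<in> {..<L}" "i < j"
    thus "zigzag v i \<noteq> zigzag v j"
      using parity[of i j] min[of "j - i"] by auto
  qed
  hence "distinct (map (zigzag v) [0..<L])"
    by (simp add: distinct_map lessThan_atLeast0)
  moreover have "zigzag v (Suc k mod L) = mate k (zigzag v k)" if "k < L" for k
    using that L(2) by (cases "Suc k = L") auto
  hence "closed_walk_edges (map (zigzag v) [0..<L]) \<subseteq> edges H"
    using zigzag_in[OF v] L(1) edges_iff[OF order_refl g_in b_in]
    by (auto simp: closed_walk_edges_def image_subset_iff)
  ultimately have "cycle (map (zigzag v) [0..<L])"
    using \<open>even L\<close> L(1) by (simp add: cycle_def)
  moreover have "v \<in> set (map (zigzag v) [0..<L])"
    using L(1) by (auto intro!: image_eqI[of _ _ 0])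
  ultimately show ?thesis by (rule that)
qed

section \<open>Counting cycles through closed sets\<close>

definition components :: "signed_nat set set" where
  "components = {set vs | vs. cycle vs}"

lemma card_cycles: "card {closed_walk_edges vs | vs. cycle vs} = card components"
proof -
  have "{closed_walk_edges vs | vs. cycle vs} = edges ` components"
    using closed_walk_edges_cycle by (auto simp: components_def)
  moreover have "inj_on edges components"
    using Union_edges closed_set_cycle by (intro inj_on_inverseI[of _ "\<lambda>E. \<Union> (snd ` E)"])
      (auto simp: components_def)
  ultimately show ?thesis by (simp add: card_image)
qed

text \<open>The components are the atoms of the closed sets: nonempty, covering \<open>H\<close>,
  and contained in every closed set that they meet. A closed set thus amounts to an arbitrary set of
  components.\<close>

lemma card_closed_sets: "card {U. closed_set U} = 2 ^ card components"
proof -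
  have comp: "closed_set K" "K \<noteq> {}" if "K \<in> components" for K
    using that closed_set_cycle by (auto simp: components_def cycle_def)
  have comp_min: "K \<subseteq> U" if "K \<in> components" "closed_set U" "v \<in> K" "v \<in> U" for K U v
    using that cycle_minimal by (auto simp: components_def)
  have "components \<subseteq> Pow H"
    using cycle_subset by (auto simp: components_def)
  hence fin: "finite components"
    using finite_H finite_subset by blast
  have "bij_betw \<Union> (Pow components) {U. closed_set U}"
  proof (rule bij_betw_byWitness[where f' = "\<lambda>U. {K \<in> components. K \<subseteq> U}"])
    show "\<forall>A\<in>Pow components. {K \<in> components. K \<subseteq> \<Union> A} = A"
    proof safe
      fix A K assume A: "A \<subseteq> components" and K: "K \<in> components" "K \<subseteq> \<Union> A"
      then obtain v where "v \<in> K" using comp by blast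
      then obtain K' where "K' \<in> A" "v \<in> K'" using K by blast
      \<comment> \<open>Two components with a common vertex contain each other by
        minimality.\<close>
      hence "K = K'"
        using A K(1) \<open>v \<in> K\<close> comp(1) comp_min[of K K' v] comp_min[of K' K v] by blast
      thus "K \<in> A" using \<open>K' \<in> A\<close> by simp
    qed auto
    show "\<forall>U\<in>{U. closed_set U}. \<Union> {K \<in> components. K \<subseteq> U} = U"
    proof safe
      fix U v assume U: "closed_set U" and v: "v \<in> U"
      hence "v \<in> H" by (auto simp: closed_set_def)
      then obtain vs where "cycle vs" "v \<in> set vs" by (rule ex_cycle)
      thus "v \<in> \<Union> {K \<in> components. K \<subseteq> U}"
        using cycle_minimal[OF _ U _ v] by (auto simp: components_def)
    qed auto
    show "\<Union> ` Pow components \<subseteq> {U. closed_set U}"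
    proof safe
      fix A assume "A \<subseteq> components"
      hence A: "closed_set K" if "K \<in> A" for K
        using comp(1) that by blast
      hence "K \<subseteq> H" if "K \<in> A" for K
        using that by (simp add: closed_set_def)
      moreover from this A have "mate j v \<in> K" if "K \<in> A" "v \<in> K" for j v K
        using that closed_setD by blast
      ultimately show "closed_set (\<Union> A)"
        by (intro closed_setI) blast+
    qed
    show "(\<lambda>U. {K \<in> components. K \<subseteq> U}) ` {U. closed_set U} \<subseteq> Pow components"
      by blast
  qed
  hence "card (Pow components) = card {U. closed_set U}"
    by (rule bij_betw_same_card)
  thus ?thesis using fin by (simp add: card_Pow)
qed

end

subsection \<open>The word of a signed permutation\<close>

definition gray_mate :: "nat \<Rightarrow> signed_nat \<Rightarrow> signed_nat" where
  "gray_mate n i = negate (cyc_succ n i)"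

text \<open>The gray matching transported by \<open>\<pi>\<close>, which is how the black edges
  arise.\<close>

definition black_mate :: "nat \<Rightarrow> (signed_nat \<Rightarrow> signed_nat) \<Rightarrow> signed_nat \<Rightarrow> signed_nat" where
  "black_mate n \<pi> v = \<pi> (gray_mate n (inv_into UNIV \<pi> v))"

lemma gray_mate_simps:
  "gray_mate n (Pos j) = (if j = n then Neg 0 else Neg (Suc j))"
  "gray_mate n (Neg j) = (if j = 0 then Pos n else Pos (j - 1))"
  by (simp_all add: gray_mate_def)

lemma H_setE:
  assumes "v \<in> H_set n"
  obtains j where "j \<le> n" "v = Pos j" | j where "j \<le> n" "v = Neg j"
  using assms by (auto simp: H_set_def)

lemma in_H_set_iff: "v \<in> H_set n \<longleftrightarrow> letter v \<le> n"
  by (cases v) (auto simp: H_set_def)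

lemma finite_H_set: "finite (H_set n)"
  by (simp add: H_set_def)

lemma in_nonzero_set_iff: "v \<in> nonzero_set n \<longleftrightarrow> 1 \<le> letter v \<and> letter v \<le> n"
  by (cases v) (auto simp: nonzero_set_def)

lemma gray_mate_in: "v \<in> H_set n \<Longrightarrow> gray_mate n v \<in> H_set n"
  and gray_mate_idem: "v \<in> H_set n \<Longrightarrow> gray_mate n (gray_mate n v) = v"
  and gray_mate_neq: "v \<in> H_set n \<Longrightarrow> gray_mate n v \<noteq> v"
  by (cases v; auto simp: in_H_set_iff gray_mate_simps)+

text \<open>One condition per gray edge, each edge being named by its positive end.\<close>

lemma gray_mate_invariant_iff:
  "(\<forall>v\<in>H_set n. R (gray_mate n v) = R v) \<longleftrightarrow>
    (\<forall>j<n. R (Neg (Suc j)) = R (Pos j)) \<and> R (Neg 0) = R (Pos n)" (is "?L \<longleftrightarrow> ?E")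
proof
  assume L: ?L
  have "R (Neg (Suc j)) = R (Pos j)" if "j < n" for j
    using L[rule_format, of "Pos j"] that by (simp add: in_H_set_iff gray_mate_simps)
  moreover have "R (Neg 0) = R (Pos n)"
    using L[rule_format, of "Pos n"] by (simp add: in_H_set_iff gray_mate_simps)
  ultimately show ?E by blast
next
  assume E: ?E
  show ?L
  proof
    fix v assume "v \<in> H_set n"
    thus "R (gray_mate n v) = R v"
    proof (cases rule: H_setE)
      case (1 j)
      thus ?thesis using E by (auto simp: gray_mate_simps)
    next
      case (2 j)
      thus ?thesis using E by (cases j) (auto simp: gray_mate_simps)
    qed
  qed
qed

lemma hyperoct_permutes: "\<pi> \<in> hyperoct n \<Longrightarrow> \<pi> permutes nonzero_set n"
  by (simp add: hyperoct_def)

lemma hyperoct_permutes_H_set: "\<pi> \<in> hyperoct n \<Longrightarrow> \<pi> permutes H_set n"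
  by (rule permutes_subset[OF hyperoct_permutes]) (auto simp: in_H_set_iff in_nonzero_set_iff)

lemma hyperoct_negate:
  assumes "\<pi> \<in> hyperoct n"
  shows "\<pi> (negate i) = negate (\<pi> i)"
proof (cases "i \<in> nonzero_set n")
  case True
  thus ?thesis using assms by (simp add: hyperoct_def)
next
  case False
  hence "negate i \<notin> nonzero_set n" by (simp add: in_nonzero_set_iff)
  thus ?thesis using False permutes_not_in[OF hyperoct_permutes[OF assms]] by simp
qed

lemma hyperoct_zero:
  assumes "\<pi> \<in> hyperoct n"
  shows "\<pi> (Pos 0) = Pos 0" "\<pi> (Neg 0) = Neg 0"
  using permutes_not_in[OF hyperoct_permutes[OF assms]] by (simp_all add: in_nonzero_set_iff)

lemma two_matchings_hyperoct:
  assumes "\<pi> \<in> hyperoct n"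
  shows "two_matchings (H_set n) (gray_mate n) (black_mate n \<pi>)"
proof
  note p = hyperoct_permutes_H_set[OF assms]
  have inv: "inv_into UNIV \<pi> v \<in> H_set n" "\<pi> (inv_into UNIV \<pi> v) = v" "inv_into UNIV \<pi> (\<pi> v) = v"
    if "v \<in> H_set n" for v
    using that p by (simp_all add: permutes_in_image permutes_inv permutes_inverses)
  fix v assume v: "v \<in> H_set n"
  show "black_mate n \<pi> v \<in> H_set n"
    using v p inv gray_mate_in by (simp add: black_mate_def permutes_in_image)
  show "black_mate n \<pi> (black_mate n \<pi> v) = v"
    using v inv gray_mate_in gray_mate_idem by (simp add: black_mate_def)
  show "black_mate n \<pi> v \<noteq> v"
    using v inv gray_mate_in[OF inv(1)[OF v]] gray_mate_neq[OF inv(1)[OF v]] by (metis black_mate_def)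
qed (simp_all add: finite_H_set gray_mate_in gray_mate_idem gray_mate_neq)

lemma breakpoint_graph_eq_edges:
  assumes "\<pi> \<in> hyperoct n"
  shows "breakpoint_graph n \<pi> = two_matchings.edges (gray_mate n) (black_mate n \<pi>) (H_set n)"
proof -
  note p = hyperoct_permutes_H_set[OF assms]
  have "{(Black, {\<pi> i, \<pi> (gray_mate n i)}) | i. i \<in> H_set n} =
      (\<lambda>v. (Black, {v, black_mate n \<pi> v})) ` \<pi> ` H_set n"
    using p by (auto simp: black_mate_def permutes_inverses image_image)
  also have "\<pi> ` H_set n = H_set n"
    by (rule permutes_image[OF p])
  finally show ?thesis
    unfolding two_matchings.edges_def[OF two_matchings_hyperoct[OF assms]] breakpoint_graph_def
      gray_mate_def[symmetric] by auto
qed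

lemma card_closed_sets_hyperoct:
  assumes "\<pi> \<in> hyperoct n"
  shows "card {U. two_matchings.closed_set (H_set n) (gray_mate n) (black_mate n \<pi>) U} =
    2 ^ num_cycles n \<pi>"
proof -
  interpret two_matchings "H_set n" "gray_mate n" "black_mate n \<pi>"
    by (rule two_matchings_hyperoct[OF assms])
  have "alternating_cycles n \<pi> = {closed_walk_edges vs | vs. cycle vs}"
    by (simp add: alternating_cycles_def cycle_def breakpoint_graph_eq_edges[OF assms])
  thus ?thesis
    by (simp add: card_closed_sets num_cycles_def card_cycles)
qed

text \<open>The edges are the incidences of the glued polygon: \<open>Pos j\<close> and
  \<open>Neg (Suc j)\<close> are the end of one letter and the start of the next, likewise along
  \<open>\<pi>\<close>, and \<open>Neg 0\<close> ties the far ends of both lines together.\<close>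

lemma closed_set_hyperoct_iff:
  assumes "\<pi> \<in> hyperoct n"
  shows "two_matchings.closed_set (H_set n) (gray_mate n) (black_mate n \<pi>) U \<longleftrightarrow> U \<subseteq> H_set n \<and>
    (\<forall>j<n. (Neg (Suc j) \<in> U) = (Pos j \<in> U)) \<and> (Neg 0 \<in> U) = (Pos n \<in> U) \<and>
    (\<forall>j<n. (\<pi> (Neg (Suc j)) \<in> U) = (\<pi> (Pos j) \<in> U)) \<and> (Neg 0 \<in> U) = (\<pi> (Pos n) \<in> U)"
proof -
  note p = hyperoct_permutes_H_set[OF assms]
  have "(\<forall>v\<in>H_set n. (black_mate n \<pi> v \<in> U) = (v \<in> U)) \<longleftrightarrow>
      (\<forall>v\<in>\<pi> ` H_set n. (black_mate n \<pi> v \<in> U) = (v \<in> U))"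
    by (simp only: permutes_image[OF p])
  also have "\<dots> \<longleftrightarrow> (\<forall>v\<in>H_set n. (\<pi> (gray_mate n v) \<in> U) = (\<pi> v \<in> U))"
    using p by (simp add: black_mate_def permutes_inverses)
  finally show ?thesis
    unfolding two_matchings.closed_set_def[OF two_matchings_hyperoct[OF assms]] ball_conj_distrib
    using gray_mate_invariant_iff[of n "\<lambda>v. v \<in> U"] gray_mate_invariant_iff[of n "\<lambda>v. \<pi> v \<in> U"]
    by (simp add: hyperoct_zero[OF assms])
qed

definition perm_word :: "nat \<Rightarrow> (signed_nat \<Rightarrow> signed_nat) \<Rightarrow> signed_nat list" where
  "perm_word n \<pi> = map Pos [1..<Suc n] @ word_inverse (map (\<lambda>i. \<pi> (Pos i)) [1..<Suc n])"

text \<open>\<open>\<pi>\<close> is odd and injective, so two positions with the same letter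
  coincide. Hence each letter occurs once in each half of \<open>perm_word\<close>.\<close>

lemma image_letter_hyperoct:
  assumes "\<pi> \<in> hyperoct n"
  shows "inj_on (\<lambda>i. letter (\<pi> (Pos i))) {1..n}" "(\<lambda>i. letter (\<pi> (Pos i))) ` {1..n} = {1..n}"
proof -
  show inj: "inj_on (\<lambda>i. letter (\<pi> (Pos i))) {1..n}"
  proof (rule inj_onI)
    fix i j assume "letter (\<pi> (Pos i)) = letter (\<pi> (Pos j))"
    hence "\<pi> (Pos i) = \<pi> (Pos j) \<or> \<pi> (Pos i) = \<pi> (Neg j)"
      using hyperoct_negate[OF assms, of "Pos j"] by (simp add: letter_eq_iff)
    thus "i = j"
      using permutes_inj[OF hyperoct_permutes[OF assms]] by (auto dest: injD)
  qed
  have "\<pi> (Pos i) \<in> nonzero_set n" if "i \<in> {1..n}" for i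
    using that permutes_in_image[OF hyperoct_permutes[OF assms]] by (simp add: in_nonzero_set_iff)
  thus "(\<lambda>i. letter (\<pi> (Pos i))) ` {1..n} = {1..n}"
    by (intro endo_inj_surj inj) (auto simp: in_nonzero_set_iff)
qed

lemma letters_map: "letters (map f xs) = (\<lambda>i. letter (f i)) ` set xs"
  by (induction xs) auto

lemma letters_perm_word:
  assumes "\<pi> \<in> hyperoct n"
  shows "letters (perm_word n \<pi>) = {1..n}"
  using image_letter_hyperoct(2)[OF assms]
  by (simp add: perm_word_def letters_map atLeastLessThanSuc_atLeastAtMost del: upt_Suc)

lemma double_word_perm_word:
  assumes "\<pi> \<in> hyperoct n"
  shows "double_word (perm_word n \<pi>)"
proof -
  have upt: "mset [1..<Suc n] = mset_set {1..n}"
    by (simp only: mset_upt atLeastLessThanSuc_atLeastAtMost)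
  have "image_mset letter (mset (perm_word n \<pi>)) =
      mset_set {1..n} + image_mset (\<lambda>i. letter (\<pi> (Pos i))) (mset_set {1..n})"
    by (simp add: perm_word_def multiset.map_comp comp_def upt del: upt_Suc One_nat_def mset_upt)
  also have "image_mset (\<lambda>i. letter (\<pi> (Pos i))) (mset_set {1..n}) = mset_set {1..n}"
    using image_letter_hyperoct[OF assms] by (simp add: image_mset_mset_set)
  finally show ?thesis
    by (simp add: double_word_def letters_perm_word[OF assms] del: count_image_mset)
qed

lemma walk_map_upt:
  "walk a c (map f [1..<Suc m]) d \<longleftrightarrow>
    (\<forall>j<m. source a (f (Suc j)) = (if j = 0 then c else target a (f j))) \<and>
    d = (if m = 0 then c else target a (f m))"
proof (induction m arbitrary: d)
  case (Suc m)
  have upt: "[1..<Suc (Suc m)] = [1..<Suc m] @ [Suc m]" by simp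
  show ?case
    by (auto simp: upt walk_append Suc less_Suc_eq simp del: upt_Suc One_nat_def)
qed auto

text \<open>With the inverted half read forwards, both halves start at \<open>c\<close> and must
  meet at their far ends.\<close>

lemma walk_perm_word:
  assumes "1 \<le> n"
  shows "walk a c (perm_word n \<pi>) c \<longleftrightarrow>
    (\<forall>j<n. source a (Pos (Suc j)) = (if j = 0 then c else target a (Pos j))) \<and>
    (\<forall>j<n. source a (\<pi> (Pos (Suc j))) = (if j = 0 then c else target a (\<pi> (Pos j)))) \<and>
    target a (Pos n) = target a (\<pi> (Pos n))"
  using assms unfolding perm_word_def walk_append walk_word_inverse walk_map_upt by auto

text \<open>The dictionary between graph and word: a nonzero vertex \<open>l\<close> stands for the
  tip of the arrow \<open>l\<close>, \<open>Pos 0\<close> for the base point, and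
  \<open>Neg 0\<close> for the point where the two halves of the word meet.\<close>

lemma closed_set_iff_walk:
  fixes a :: "nat \<Rightarrow> bool \<times> bool"
  assumes \<pi>: "\<pi> \<in> hyperoct n" and n: "1 \<le> n" and U: "U \<subseteq> H_set n"
    and c: "Pos 0 \<in> U \<longleftrightarrow> c" and N: "Neg 0 \<in> U \<longleftrightarrow> target a (Pos n)"
    and a: "\<And>l. l \<in> nonzero_set n \<Longrightarrow> l \<in> U \<longleftrightarrow> target a l"
  shows "two_matchings.closed_set (H_set n) (gray_mate n) (black_mate n \<pi>) U \<longleftrightarrow>
    walk a c (perm_word n \<pi>) c"
proof -
  have nz: "\<pi> (Pos j) \<in> nonzero_set n" if "1 \<le> j" "j \<le> n" for j
    using that permutes_in_image[OF hyperoct_permutes[OF \<pi>]] by (simp add: in_nonzero_set_iff)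
  have outward: "(Pos j \<in> U) = (if j = 0 then c else target a (Pos j))"
    "(\<pi> (Pos j) \<in> U) = (if j = 0 then c else target a (\<pi> (Pos j)))" if "j \<le> n" for j
    using that c a nz by (auto simp: hyperoct_zero[OF \<pi>] in_nonzero_set_iff)
  have inward: "(Neg (Suc j) \<in> U) = source a (Pos (Suc j))"
    "(\<pi> (Neg (Suc j)) \<in> U) = source a (\<pi> (Pos (Suc j)))" if "j < n" for j
  proof -
    show "(Neg (Suc j) \<in> U) = source a (Pos (Suc j))"
      using that a[of "Neg (Suc j)"] by (simp add: in_nonzero_set_iff target_def)
    have "\<pi> (Neg (Suc j)) = negate (\<pi> (Pos (Suc j)))"
      using hyperoct_negate[OF \<pi>, of "Pos (Suc j)"] by simp
    thus "(\<pi> (Neg (Suc j)) \<in> U) = source a (\<pi> (Pos (Suc j)))"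
      using that a[of "negate (\<pi> (Pos (Suc j)))"] nz[of "Suc j"]
      by (simp add: in_nonzero_set_iff)
  qed
  show ?thesis
    unfolding closed_set_hyperoct_iff[OF \<pi>] walk_perm_word[OF n] N
    using U n by (simp add: outward inward)
qed

text \<open>A closed set amounts to a base colour together with a colouring for it, so the sum over
  both base colours counts all closed sets.\<close>

lemma sum_card_colourings:
  assumes \<pi>: "\<pi> \<in> hyperoct n" and n: "1 \<le> n"
  shows "(\<Sum>c\<in>UNIV. card (colourings (perm_word n \<pi>) c)) = 2 ^ num_cycles n \<pi>"
proof -
  let ?w = "perm_word n \<pi>"
  let ?C = "two_matchings.closed_set (H_set n) (gray_mate n) (black_mate n \<pi>)"
  let ?S = "SIGMA c:UNIV. colourings ?w c"
  \<comment> \<open>The arrow of \<open>j\<close> runs from the colour of \<open>Neg j\<close> to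
    the colour of \<open>Pos j\<close>.\<close>
  let ?f = "\<lambda>U. (Pos 0 \<in> U, \<lambda>j\<in>{1..n}. (Neg j \<in> U, Pos j \<in> U))"
  \<comment> \<open>\<open>Neg 0\<close> is joined to \<open>Pos n\<close> by a gray edge, so its
    colour is forced.\<close>
  let ?h = "\<lambda>(c, a). {l \<in> H_set n. if l = Pos 0 then c else if l = Neg 0 then target a (Pos n)
    else target a l}"
  have target_f: "target (snd (?f U)) l \<longleftrightarrow> l \<in> U" if "l \<in> nonzero_set n" for U l
    using that by (cases l) (auto simp: target_def in_nonzero_set_iff)
  have C_sub: "U \<subseteq> H_set n" "Neg 0 \<in> U \<longleftrightarrow> Pos n \<in> U" if "?C U" for U
    using that unfolding closed_set_hyperoct_iff[OF \<pi>] by blast+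
  have nz: "Pos n \<in> nonzero_set n" using n by (simp add: in_nonzero_set_iff)
  have h: "?h (c, a) \<subseteq> H_set n" "Pos 0 \<in> ?h (c, a) \<longleftrightarrow> c" "Neg 0 \<in> ?h (c, a) \<longleftrightarrow> target a (Pos n)"
    "\<And>l. l \<in> nonzero_set n \<Longrightarrow> l \<in> ?h (c, a) \<longleftrightarrow> target a l" for c a
    by (auto simp: in_H_set_iff in_nonzero_set_iff)
  have "bij_betw ?f {U. ?C U} ?S"
  proof (rule bij_betw_byWitness[where f' = ?h])
    show "\<forall>U\<in>{U. ?C U}. ?h (?f U) = U"
    proof
      fix U assume "U \<in> {U. ?C U}"
      hence U: "?C U" by simp
      have "l \<in> ?h (?f U) \<longleftrightarrow> l \<in> U" for l
      proof (cases "l \<in> nonzero_set n")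
        case True
        thus ?thesis using h(4)[OF True, of "fst (?f U)" "snd (?f U)"] target_f[OF True, of U] by simp
      next
        case False
        show ?thesis
        proof (cases "letter l = 0")
          case True
          hence "l = Pos 0 \<or> l = Neg 0" by (cases l) auto
          thus ?thesis
            using h(2,3)[of "fst (?f U)" "snd (?f U)"] target_f[OF nz, of U] C_sub(2)[OF U] by auto
        next
          case l: False
          hence "l \<notin> H_set n"
            using False by (simp add: in_H_set_iff in_nonzero_set_iff)
          thus ?thesis using h(1)[of "fst (?f U)" "snd (?f U)"] C_sub(1)[OF U] by auto
        qed
      qed
      thus "?h (?f U) = U" by blast
    qed
    show "\<forall>p\<in>?S. ?f (?h p) = p"
    proof
      fix p assume "p \<in> ?S"
      then obtain c a where p: "p = (c, a)" and "a \<in> colourings ?w c" by (rule SigmaE)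
      hence ext: "a \<in> extensional {1..n}"
        by (simp add: colourings_def letters_perm_word[OF \<pi>] PiE_def)
      have "(\<lambda>j\<in>{1..n}. (Neg j \<in> ?h (c, a), Pos j \<in> ?h (c, a))) = a"
      proof (rule extensionalityI[OF _ ext])
        fix j assume "j \<in> {1..n}"
        thus "(\<lambda>j\<in>{1..n}. (Neg j \<in> ?h (c, a), Pos j \<in> ?h (c, a))) j = a j"
          using h(4)[of "Neg j" c a] h(4)[of "Pos j" c a]
          by (cases "a j") (simp add: in_nonzero_set_iff target_def)
      qed simp
      thus "?f (?h p) = p"
        unfolding p using h(2)[of c a] by simp
    qed
    show "?f ` {U. ?C U} \<subseteq> ?S"
    proof (rule image_subsetI)
      fix U assume "U \<in> {U. ?C U}"
      hence U: "?C U" by simp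
      have "walk (snd (?f U)) (Pos 0 \<in> U) ?w (Pos 0 \<in> U)"
        using closed_set_iff_walk[OF \<pi> n C_sub(1)[OF U] refl, of "snd (?f U)"] U
          target_f[OF nz, of U] target_f[of _ U] C_sub(2)[OF U] by blast
      thus "?f U \<in> ?S"
        by (simp add: colourings_def letters_perm_word[OF \<pi>])
    qed
    show "?h ` ?S \<subseteq> {U. ?C U}"
    proof (rule image_subsetI)
      fix p assume "p \<in> ?S"
      then obtain c a where p: "p = (c, a)" and "a \<in> colourings ?w c" by (rule SigmaE)
      hence "walk a c ?w c" by (simp add: colourings_def)
      hence "?C (?h (c, a))"
        using closed_set_iff_walk[OF \<pi> n h(1,2,3,4)] by blast
      thus "?h p \<in> {U. ?C U}"
        unfolding p by (rule CollectI)
    qed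
  qed
  hence "card {U. ?C U} = card ?S"
    by (rule bij_betw_same_card)
  thus ?thesis
    using card_closed_sets_hyperoct[OF \<pi>] by (simp add: card_SigmaI finite_colourings)
qed

section \<open>From solution counts to probabilities\<close>

context finite_group
begin

lemma perm_prob_eq:
  assumes \<pi>: "\<pi> \<in> hyperoct n"
  shows "perm_prob G n \<pi> = card (solutions (perm_word n \<pi>) \<one>) / card ({1..n} \<rightarrow>\<^sub>E carrier G)"
proof -
  let ?A = "{1..n} \<rightarrow>\<^sub>E carrier G"
  let ?u = "map Pos [1..<Suc n]" and ?v = "map (\<lambda>i. \<pi> (Pos i)) [1..<Suc n]"
  let ?E = "{a. list_prod G (map a [1..<Suc n]) =
    list_prod G (map (\<lambda>i. signed_value G a (\<pi> (Pos i))) [1..<Suc n])}"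
  have letters: "letters ?u = {1..n}" "letters ?v = {1..n}"
    using image_letter_hyperoct(2)[OF \<pi>]
    by (simp_all add: letters_map atLeastLessThanSuc_atLeastAtMost del: upt_Suc)
  have "a \<in> ?E \<longleftrightarrow> word_value a (perm_word n \<pi>) = \<one>" if "a \<in> ?A" for a
  proof -
    have a: "a ` {1..n} \<subseteq> carrier G" using that by auto
    hence closed: "word_value a ?u \<in> carrier G" "word_value a ?v \<in> carrier G"
      by (simp_all only: word_value_closed letters)
    have "a \<in> ?E \<longleftrightarrow> word_value a ?u = word_value a ?v"
      by (simp add: word_value_def comp_def del: upt_Suc)
    also have "\<dots> \<longleftrightarrow> word_value a ?u \<otimes> inv (word_value a ?v) = \<one>"
      using closed by (metis inv_closed inv_equality inv_inv r_inv)
    also have "word_value a ?u \<otimes> inv (word_value a ?v) = word_value a (perm_word n \<pi>)"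
      unfolding perm_word_def using a
      by (simp add: word_value_append word_value_word_inverse letters del: upt_Suc One_nat_def)
    finally show ?thesis .
  qed
  hence "?A \<inter> ?E = solutions (perm_word n \<pi>) \<one>"
    by (auto simp: solutions_def letters_perm_word[OF \<pi>])
  \<comment> \<open>Independent uniform letters form a uniform function; the default
    \<open>undefined\<close> makes the product space the space of extensional functions.\<close>
  moreover have "Pi_pmf {1..n} undefined (\<lambda>_. pmf_of_set (carrier G)) = pmf_of_set ?A"
  proof -
    have "PiE_dflt {1..n} undefined (\<lambda>_. carrier G) = ?A"
      by (auto simp: PiE_dflt_def PiE_def extensional_def Pi_def)
    thus ?thesis
      using finite_carrier one_closed by (subst Pi_pmf_of_set) auto
  qed
  moreover have "?A \<noteq> {}" "finite ?A"
    using one_closed by (auto simp: PiE_eq_empty_iff finite_PiE finite_carrier)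
  ultimately show ?thesis
    unfolding perm_prob_def by (simp add: measure_pmf_of_set)
qed

lemma perm_prob_eq_iff:
  assumes "\<theta> \<in> hyperoct n" "\<pi> \<in> hyperoct n"
  shows "perm_prob G n \<theta> = perm_prob G n \<pi> \<longleftrightarrow>
    card (solutions (perm_word n \<theta>) \<one>) = card (solutions (perm_word n \<pi>) \<one>)"
proof -
  have "card ({1..n} \<rightarrow>\<^sub>E carrier G) \<noteq> 0"
    using one_closed finite_carrier by (auto simp: card_PiE card_eq_0_iff)
  thus ?thesis by (simp add: perm_prob_eq assms)
qed

text \<open>Each of the two base colours contributes \<open>2 ^ v\<close>, so there are
  \<open>v + 1\<close> cycles. The number of cycles thus fixes \<open>v\<close>, and with it the
  number of solutions.\<close>

lemma perm_prob_cong: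
  assumes "ambivalent G" and n: "1 \<le> n" and "\<theta> \<in> hyperoct n" "\<pi> \<in> hyperoct n"
    and cycles: "num_cycles n \<theta> = num_cycles n \<pi>"
  shows "perm_prob G n \<theta> = perm_prob G n \<pi>"
proof -
  have "\<exists>v. num_cycles n \<sigma> = Suc v \<and>
      card (solutions (perm_word n \<sigma>) \<one>) = card (carrier G) ^ v * square_products (n - v) \<one>"
    if \<sigma>: "\<sigma> \<in> hyperoct n" for \<sigma>
  proof -
    have "determined (perm_word n \<sigma>)"
      by (rule determined_double_word[OF assms(1) double_word_perm_word[OF \<sigma>]])
    then obtain v where v: "\<And>c. card (colourings (perm_word n \<sigma>) c) = 2 ^ v"
      "card (solutions (perm_word n \<sigma>) \<one>) = card (carrier G) ^ v * square_products (n - v) \<one>"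
      using letters_perm_word[OF \<sigma>] by (auto simp: determined_def)
    have "(2::nat) ^ num_cycles n \<sigma> = 2 ^ Suc v"
      using sum_card_colourings[OF \<sigma> n] by (simp add: v(1) UNIV_bool)
    hence "num_cycles n \<sigma> = Suc v" by (rule power_inject_exp[THEN iffD1, rotated]) simp
    thus ?thesis using v(2) by blast
  qed
  from this[OF assms(3)] this[OF assms(4)] show ?thesis
    using cycles by (auto simp: perm_prob_eq_iff assms)
qed

end

subsection \<open>Torus and Klein bottle\<close>

text \<open>In one-line form \<open>2, 1\<close>, with the equation
  \<open>a1 a2 = a2 a1\<close>.\<close>

definition torus :: "signed_nat \<Rightarrow> signed_nat" where
  "torus = id(Pos 1 := Pos 2, Pos 2 := Pos 1, Neg 1 := Neg 2, Neg 2 := Neg 1)"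

text \<open>In one-line form \<open>-2, 1\<close>, with the equation
  \<open>a1 a2 = (inv a2) a1\<close>.\<close>

definition klein_bottle :: "signed_nat \<Rightarrow> signed_nat" where
  "klein_bottle = id(Pos 1 := Neg 2, Pos 2 := Pos 1, Neg 1 := Pos 2, Neg 2 := Neg 1)"

lemma nonzero_set_2: "nonzero_set 2 = {Pos 1, Pos 2, Neg 1, Neg 2}"
proof -
  have "{1..2} = {1, 2::nat}" by auto
  thus ?thesis by (auto simp: nonzero_set_def)
qed

lemma torus_hyperoct: "torus \<in> hyperoct 2"
proof -
  have "torus permutes nonzero_set 2"
    unfolding nonzero_set_2
    by (rule bij_imp_permutes) (auto simp: torus_def bij_betw_def inj_on_def)
  thus ?thesis by (simp add: hyperoct_def nonzero_set_2 torus_def)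
qed

lemma klein_bottle_hyperoct: "klein_bottle \<in> hyperoct 2"
proof -
  have "klein_bottle permutes nonzero_set 2"
    unfolding nonzero_set_2
    by (rule bij_imp_permutes) (auto simp: klein_bottle_def bij_betw_def inj_on_def)
  thus ?thesis by (simp add: hyperoct_def nonzero_set_2 klein_bottle_def)
qed

lemma perm_word_torus: "perm_word 2 torus = [Pos 1, Pos 2, Neg 1, Neg 2]"
  and perm_word_klein_bottle: "perm_word 2 klein_bottle = [Pos 1, Pos 2, Neg 1, Pos 2]"
proof -
  have "[1..<Suc 2] = [1, 2]" by (simp add: upt_rec)
  thus "perm_word 2 torus = [Pos 1, Pos 2, Neg 1, Neg 2]"
    "perm_word 2 klein_bottle = [Pos 1, Pos 2, Neg 1, Pos 2]"
    by (simp_all add: perm_word_def torus_def klein_bottle_def del: upt_Suc)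
qed

text \<open>In both words the incidences force every end of an arrow to have the base colour, so the
  two have the same colourings.\<close>

lemma num_cycles_torus: "num_cycles 2 torus = num_cycles 2 klein_bottle"
proof -
  have "colourings (perm_word 2 torus) c = colourings (perm_word 2 klein_bottle) c" for c
    unfolding colourings_def perm_word_torus perm_word_klein_bottle
    by (intro Collect_cong conj_cong) (auto simp: target_def)
  hence "(2::nat) ^ num_cycles 2 torus = 2 ^ num_cycles 2 klein_bottle"
    using sum_card_colourings[OF torus_hyperoct] sum_card_colourings[OF klein_bottle_hyperoct] by simp
  thus ?thesis by simp
qed

context finite_group
begin

text \<open>The elements inverting \<open>y\<close> are either absent or form a coset of the
  centralizer of \<open>y\<close>, the set on the right.\<close>

lemma card_inverting_le:
  assumes y: "y \<in> carrier G"
  shows "card {t \<in> carrier G. t \<otimes> y \<otimes> inv t = inv y} \<le> card {t \<in> carrier G. t \<otimes> y \<otimes> inv t = y}"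
proof (cases "\<exists>h\<in>carrier G. h \<otimes> y \<otimes> inv h = inv y")
  case True
  then obtain h where h: "h \<in> carrier G" "h \<otimes> y \<otimes> inv h = inv y" by blast
  have "t \<otimes> inv y \<otimes> inv t = inv y \<longleftrightarrow> t \<otimes> y \<otimes> inv t = y" if t: "t \<in> carrier G" for t
  proof -
    have "t \<otimes> inv y \<otimes> inv t = inv (t \<otimes> y \<otimes> inv t)"
      using t y by (simp add: inv_mult_group m_assoc)
    thus ?thesis using t y by (metis inv_closed inv_inv m_closed)
  qed
  hence "{t \<in> carrier G. t \<otimes> inv y \<otimes> inv t = inv y} = {t \<in> carrier G. t \<otimes> y \<otimes> inv t = y}" by blast
  thus ?thesis using card_conjugator_subst[OF h(1) y h(2), of "inv y"] by simp
next
  case False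
  hence "{t \<in> carrier G. t \<otimes> y \<otimes> inv t = inv y} = {}" by blast
  thus ?thesis by (simp only: card.empty le0)
qed

text \<open>Solves for the first letter; \<open>k = Neg 2\<close> gives the torus and
  \<open>k = Pos 2\<close> the Klein bottle.\<close>

lemma card_solutions_two_letters:
  assumes k: "letter k = 2"
  shows "card (solutions [Pos 1, Pos 2, Neg 1, k] \<one>) = (\<Sum>a\<in>({2} \<rightarrow>\<^sub>E carrier G).
    card {t \<in> carrier G. t \<otimes> a 2 \<otimes> inv t = inv (signed_value G a k)})"
proof -
  have "letters [Pos 1, Pos 2, Neg 1, k] = insert 1 {2}" using k by auto
  hence "card (solutions [Pos 1, Pos 2, Neg 1, k] \<one>) = (\<Sum>a\<in>({2} \<rightarrow>\<^sub>E carrier G).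
      card {t \<in> carrier G. word_value (a(1 := t)) [Pos 1, Pos 2, Neg 1, k] = \<one>})"
    by (rule card_solutions_remove) auto
  also have "\<dots> = (\<Sum>a\<in>({2} \<rightarrow>\<^sub>E carrier G).
      card {t \<in> carrier G. t \<otimes> a 2 \<otimes> inv t = inv (signed_value G a k)})"
  proof (rule sum.cong[OF refl])
    fix a :: "nat \<Rightarrow> 'a" assume "a \<in> {2} \<rightarrow>\<^sub>E carrier G"
    hence "a 2 \<in> carrier G" by auto
    hence a: "a 2 \<in> carrier G" "signed_value G a k \<in> carrier G" using k by simp_all
    have "word_value (a(1 := t)) [Pos 1, Pos 2, Neg 1, k] = \<one> \<longleftrightarrow>
        t \<otimes> a 2 \<otimes> inv t = inv (signed_value G a k)" if t: "t \<in> carrier G" for t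
    proof -
      have "signed_value G (a(1 := t)) k = signed_value G a k"
        using k by (cases k) auto
      hence "word_value (a(1 := t)) [Pos 1, Pos 2, Neg 1, k] =
          (t \<otimes> a 2 \<otimes> inv t) \<otimes> signed_value G a k"
        using a t by (simp add: m_assoc)
      thus ?thesis
        using a t by (metis inv_closed inv_equality inv_inv l_inv m_closed)
    qed
    thus "card {t \<in> carrier G. word_value (a(1 := t)) [Pos 1, Pos 2, Neg 1, k] = \<one>} =
        card {t \<in> carrier G. t \<otimes> a 2 \<otimes> inv t = inv (signed_value G a k)}"
      by (intro arg_cong[where f = card]) blast
  qed
  finally show ?thesis .
qed

text \<open>Summed over \<open>y\<close>, the elements inverting \<open>y\<close> are as numerous as
  those commuting with it. As the former never outnumber the latter for a single \<open>y\<close>,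
  the counts agree for each \<open>y\<close>.\<close>

lemma ambivalent_if_torus_eq_klein_bottle:
  assumes "perm_prob G 2 torus = perm_prob G 2 klein_bottle"
  shows "ambivalent G"
  unfolding ambivalent_def
proof
  fix y assume y: "y \<in> carrier G"
  let ?A = "{2::nat} \<rightarrow>\<^sub>E carrier G"
  let ?c = "\<lambda>a :: nat \<Rightarrow> 'a. card {t \<in> carrier G. t \<otimes> a 2 \<otimes> inv t = a 2}"
  let ?r = "\<lambda>a :: nat \<Rightarrow> 'a. card {t \<in> carrier G. t \<otimes> a 2 \<otimes> inv t = inv (a 2)}"
  have "(\<Sum>a\<in>?A. card {t \<in> carrier G. t \<otimes> a 2 \<otimes> inv t = inv (signed_value G a (Neg 2))}) = (\<Sum>a\<in>?A. ?c a)"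
    by (rule sum.cong) (auto simp: PiE_iff)
  moreover have "card (solutions [Pos 1, Pos 2, Neg 1, Pos 2] \<one>) =
      card (solutions [Pos 1, Pos 2, Neg 1, Neg 2] \<one>)"
    using assms unfolding perm_prob_eq_iff[OF torus_hyperoct klein_bottle_hyperoct]
      perm_word_torus perm_word_klein_bottle by simp
  ultimately have sums: "(\<Sum>a\<in>?A. ?r a) = (\<Sum>a\<in>?A. ?c a)"
    using card_solutions_two_letters[of "Pos 2"] card_solutions_two_letters[of "Neg 2"] by simp
  let ?a = "\<lambda>i\<in>{2::nat}. y"
  have "?r ?a = ?c ?a"
  proof (rule sum_mono_inv[OF sums, where i = ?a])
    show "?r a \<le> ?c a" if "a \<in> ?A" for a
      using that by (intro card_inverting_le) auto
    show "?a \<in> ?A" using y by simp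
    show "finite ?A" by (simp add: finite_PiE finite_carrier)
  qed
  hence "card {t \<in> carrier G. t \<otimes> y \<otimes> inv t = inv y} = card {t \<in> carrier G. t \<otimes> y \<otimes> inv t = y}"
    by simp
  \<comment> \<open>The identity commutes with \<open>y\<close>, so the common count is
    positive.\<close>
  moreover have "\<one> \<in> {t \<in> carrier G. t \<otimes> y \<otimes> inv t = y}" using y by simp
  hence "card {t \<in> carrier G. t \<otimes> y \<otimes> inv t = y} \<noteq> 0" using finite_carrier by auto
  ultimately have "{t \<in> carrier G. t \<otimes> y \<otimes> inv t = inv y} \<noteq> {}" by (metis card.empty)
  thus "\<exists>h\<in>carrier G. h \<otimes> y \<otimes> inv h = inv y" by blast
qed

end

theorem corollary5p7:
  fixes G :: "('a, 'b) monoid_scheme"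
  assumes "group G" and "finite (carrier G)"
  shows "(\<forall>n\<ge>1. \<forall>\<theta>\<in>hyperoct n. \<forall>\<pi>\<in>hyperoct n.
            num_cycles n \<theta> = num_cycles n \<pi> \<longrightarrow> perm_prob G n \<theta> = perm_prob G n \<pi>)
         \<longleftrightarrow> ambivalent G"
proof -
  interpret finite_group G
    using assms by (simp add: finite_group_def finite_group_axioms_def)
  show ?thesis
  proof
    assume "\<forall>n\<ge>1. \<forall>\<theta>\<in>hyperoct n. \<forall>\<pi>\<in>hyperoct n.
      num_cycles n \<theta> = num_cycles n \<pi> \<longrightarrow> perm_prob G n \<theta> = perm_prob G n \<pi>"
    \<comment> \<open>The torus and the Klein bottle are compared in the instance
      \<open>n = 2\<close>.\<close>
    moreover have "(1::nat) \<le> 2" by simp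
    ultimately show "ambivalent G"
      using torus_hyperoct klein_bottle_hyperoct num_cycles_torus
        ambivalent_if_torus_eq_klein_bottle by blast
  qed (use perm_prob_cong in blast)
qed

end
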